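(* Let $L$ be a free Lie algebra of rank greater than $2$ over a field $K$. Then the polynomial ring $K[t]$ in one variable $t$ is e-interpretable in $L$.
   Context: A subset $X\subseteq L^m$ is e-definable (Diophantine) in $L$ if there is a finite system of equations $\Sigma(x_1,\dots,x_m,y_1,\dots,y_k)$ with coefficients in $L$ such that $(c_1,\dots,c_m)\in X$ iff $\Sigma(c_1,\dots,c_m,y_1,\dots,y_k)$ has a solution in $L$. A map $\phi:X\subseteq L^m\to\mathcal A$ onto an algebraic structure $\mathcal A$ is an e-interpretation of $\mathcal A$ in $L$ if $X$ is e-definable in $L$, and the preimages under $\phi$ of the equality relation and of the graphs of all functions and predicates of $\mathcal A$ (here ring addition and multiplication) are e-definable in $L$. *)

theory Defs
  imports Complex_Main "HOL-Computational_Algebra.Polynomial"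
begin

section \<open>Lie algebras over a field\<close>

locale lie_algebra = vector_space scale
  for scale :: "'k::field \<Rightarrow> 'l::ab_group_add \<Rightarrow> 'l" +
  fixes bracket :: "'l \<Rightarrow> 'l \<Rightarrow> 'l"
  assumes bracket_add_left: "bracket (x + y) z = bracket x z + bracket y z"
    and bracket_add_right: "bracket x (y + z) = bracket x y + bracket x z"
    and bracket_scale_left: "bracket (scale k x) y = scale k (bracket x y)"
    and bracket_scale_right: "bracket x (scale k y) = scale k (bracket x y)"
    and bracket_self: "bracket x x = 0"
    and jacobi: "bracket x (bracket y z) + bracket y (bracket z x) + bracket z (bracket x y) = 0"

definition lie_hom ::
  "('k::field \<Rightarrow> 'l::ab_group_add \<Rightarrow> 'l) \<Rightarrow> ('l \<Rightarrow> 'l \<Rightarrow> 'l) \<Rightarrow>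
   ('k \<Rightarrow> 'm::ab_group_add \<Rightarrow> 'm) \<Rightarrow> ('m \<Rightarrow> 'm \<Rightarrow> 'm) \<Rightarrow> ('l \<Rightarrow> 'm) \<Rightarrow> bool" where
  "lie_hom scale bracket scale' bracket' h \<longleftrightarrow>
     Vector_Spaces.linear scale scale' h \<and> (\<forall>x y. h (bracket x y) = bracket' (h x) (h y))"


section \<open>Free Lie algebras\<close>

text \<open>
  The free Lie algebra on the generators \<open>'x\<close> over \<open>'k\<close> is constructed as the algebra of formal
  expressions modulo the congruence generated by the axioms of Lie algebras over \<open>'k\<close>.
\<close>

datatype ('x, 'k) lie_expr =
    EGen 'x
  | EZero
  | EAdd "('x, 'k) lie_expr" "('x, 'k) lie_expr"
  | EScale 'k "('x, 'k) lie_expr"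
  | EBracket "('x, 'k) lie_expr" "('x, 'k) lie_expr"

inductive lie_cong :: "('x, 'k::field) lie_expr \<Rightarrow> ('x, 'k) lie_expr \<Rightarrow> bool" where
  refl: "lie_cong s s"
| sym: "lie_cong s t \<Longrightarrow> lie_cong t s"
| trans: "lie_cong s t \<Longrightarrow> lie_cong t u \<Longrightarrow> lie_cong s u"
| cong_add: "lie_cong s s' \<Longrightarrow> lie_cong t t' \<Longrightarrow> lie_cong (EAdd s t) (EAdd s' t')"
| cong_scale: "lie_cong s s' \<Longrightarrow> lie_cong (EScale k s) (EScale k s')"
| cong_bracket: "lie_cong s s' \<Longrightarrow> lie_cong t t' \<Longrightarrow> lie_cong (EBracket s t) (EBracket s' t')"
| add_assoc: "lie_cong (EAdd (EAdd s t) u) (EAdd s (EAdd t u))"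
| add_comm: "lie_cong (EAdd s t) (EAdd t s)"
| add_zero: "lie_cong (EAdd EZero s) s"
| add_neg: "lie_cong (EAdd (EScale (- 1) s) s) EZero"
| scale_add_right: "lie_cong (EScale k (EAdd s t)) (EAdd (EScale k s) (EScale k t))"
| scale_add_left: "lie_cong (EScale (k + l) s) (EAdd (EScale k s) (EScale l s))"
| scale_scale: "lie_cong (EScale k (EScale l s)) (EScale (k * l) s)"
| scale_one: "lie_cong (EScale 1 s) s"
| bracket_add_left: "lie_cong (EBracket (EAdd s t) u) (EAdd (EBracket s u) (EBracket t u))"
| bracket_add_right: "lie_cong (EBracket s (EAdd t u)) (EAdd (EBracket s t) (EBracket s u))"
| bracket_scale_left: "lie_cong (EBracket (EScale k s) t) (EScale k (EBracket s t))"
| bracket_scale_right: "lie_cong (EBracket s (EScale k t)) (EScale k (EBracket s t))"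
| bracket_self: "lie_cong (EBracket s s) EZero"
| jacobi: "lie_cong (EAdd (EAdd (EBracket s (EBracket t u)) (EBracket t (EBracket u s)))
                          (EBracket u (EBracket s t))) EZero"

quotient_type (overloaded) ('x, 'k) free_lie = "('x, 'k::field) lie_expr" / lie_cong
  by (rule equivpI)
     (auto intro!: reflpI sympI transpI intro: lie_cong.refl lie_cong.sym lie_cong.trans)

instantiation free_lie :: (type, field) ab_group_add
begin

lift_definition zero_free_lie :: "('a, 'b) free_lie" is EZero .

lift_definition plus_free_lie :: "('a, 'b) free_lie \<Rightarrow> ('a, 'b) free_lie \<Rightarrow> ('a, 'b) free_lie"
  is EAdd by (rule lie_cong.cong_add)

lift_definition uminus_free_lie :: "('a, 'b) free_lie \<Rightarrow> ('a, 'b) free_lie"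
  is "EScale (- 1)" by (rule lie_cong.cong_scale)

definition minus_free_lie :: "('a, 'b) free_lie \<Rightarrow> ('a, 'b) free_lie \<Rightarrow> ('a, 'b) free_lie"
  where "minus_free_lie x y = x + - y"

instance
proof
  fix x y z :: "('a, 'b) free_lie"
  show "x + y + z = x + (y + z)" by transfer (rule lie_cong.add_assoc)
  show "x + y = y + x" by transfer (rule lie_cong.add_comm)
  show "0 + x = x" by transfer (rule lie_cong.add_zero)
  show "- x + x = 0" by transfer (rule lie_cong.add_neg)
  show "x - y = x + - y" by (rule minus_free_lie_def)
qed

end

lift_definition free_gen :: "'x \<Rightarrow> ('x, 'k::field) free_lie" is EGen .

lift_definition free_scale :: "'k \<Rightarrow> ('x, 'k::field) free_lie \<Rightarrow> ('x, 'k) free_lie"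
  is EScale by (rule lie_cong.cong_scale)

lift_definition free_bracket ::
  "('x, 'k::field) free_lie \<Rightarrow> ('x, 'k) free_lie \<Rightarrow> ('x, 'k) free_lie"
  is EBracket by (rule lie_cong.cong_bracket)

lemma lie_algebra_free:
  "lie_algebra (free_scale :: 'k::field \<Rightarrow> ('x, 'k) free_lie \<Rightarrow> ('x, 'k) free_lie) free_bracket"
proof
  fix k l :: 'k and x y z :: "('x, 'k) free_lie"
  show "free_scale k (x + y) = free_scale k x + free_scale k y"
    by transfer (rule lie_cong.scale_add_right)
  show "free_scale (k + l) x = free_scale k x + free_scale l x"
    by transfer (rule lie_cong.scale_add_left)
  show "free_scale k (free_scale l x) = free_scale (k * l) x"
    by transfer (rule lie_cong.scale_scale)
  show "free_scale 1 x = x"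
    by transfer (rule lie_cong.scale_one)
  show "free_bracket (x + y) z = free_bracket x z + free_bracket y z"
    by transfer (rule lie_cong.bracket_add_left)
  show "free_bracket x (y + z) = free_bracket x y + free_bracket x z"
    by transfer (rule lie_cong.bracket_add_right)
  show "free_bracket (free_scale k x) y = free_scale k (free_bracket x y)"
    by transfer (rule lie_cong.bracket_scale_left)
  show "free_bracket x (free_scale k y) = free_scale k (free_bracket x y)"
    by transfer (rule lie_cong.bracket_scale_right)
  show "free_bracket x x = 0"
    by transfer (rule lie_cong.bracket_self)
  show "free_bracket x (free_bracket y z) + free_bracket y (free_bracket z x) +
      free_bracket z (free_bracket x y) = 0"
    by transfer (rule lie_cong.jacobi)
qed

definition free_lie_algebra ::
  "('k::field \<Rightarrow> 'l::ab_group_add \<Rightarrow> 'l) \<Rightarrow> ('l \<Rightarrow> 'l \<Rightarrow> 'l) \<Rightarrow> ('x \<Rightarrow> 'l) \<Rightarrow> bool" where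
  "free_lie_algebra scale bracket basis \<longleftrightarrow>
     lie_algebra scale bracket \<and>
     (\<exists>h. bij h \<and> lie_hom free_scale free_bracket scale bracket h \<and>
          (\<forall>x. h (free_gen x) = basis x))"

primrec eval_expr ::
  "('k \<Rightarrow> 'm::ab_group_add \<Rightarrow> 'm) \<Rightarrow> ('m \<Rightarrow> 'm \<Rightarrow> 'm) \<Rightarrow> ('x \<Rightarrow> 'm) \<Rightarrow> ('x, 'k) lie_expr \<Rightarrow> 'm" where
  "eval_expr sc br f (EGen x) = f x"
| "eval_expr sc br f EZero = 0"
| "eval_expr sc br f (EAdd s t) = eval_expr sc br f s + eval_expr sc br f t"
| "eval_expr sc br f (EScale k s) = sc k (eval_expr sc br f s)"
| "eval_expr sc br f (EBracket s t) = br (eval_expr sc br f s) (eval_expr sc br f t)"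

lemma eval_expr_cong:
  assumes "lie_algebra sc br" and "lie_cong s t"
  shows "eval_expr sc br f s = eval_expr sc br f t"
proof -
  interpret lie_algebra sc br by (rule assms(1))
  show ?thesis
    using assms(2)
    by induction
       (simp_all add: algebra_simps scale_left_distrib scale_right_distrib bracket_add_left
          bracket_add_right bracket_scale_left bracket_scale_right bracket_self
          jacobi[simplified add.assoc])
qed

text \<open>The universal property, for Lie algebras on arbitrary types.\<close>

lemma free_lie_universal:
  fixes sc :: "'k::field \<Rightarrow> 'm::ab_group_add \<Rightarrow> 'm" and f :: "'x \<Rightarrow> 'm"
  assumes "lie_algebra sc br"
  shows "\<exists>!h. lie_hom free_scale free_bracket sc br h \<and> (\<forall>x. h (free_gen x) = f x)"
proof -
  interpret M: lie_algebra sc br by (rule assms)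
  interpret F: lie_algebra "free_scale :: 'k \<Rightarrow> ('x, 'k) free_lie \<Rightarrow> _" free_bracket
    by (rule lie_algebra_free)
  define h where "h v = eval_expr sc br f (rep_free_lie v)" for v
  have h_abs: "h (abs_free_lie s) = eval_expr sc br f s" for s
    unfolding h_def
    by (rule eval_expr_cong[OF assms], rule Quotient_rep_abs[OF Quotient_free_lie])
       (rule lie_cong.refl)
  have abs_ex: "\<exists>s. v = abs_free_lie s" for v :: "('x, 'k) free_lie"
    by (metis Quotient_abs_rep[OF Quotient_free_lie])
  have h_hom: "h (u + v) = h u + h v" "h (free_scale k u) = sc k (h u)"
    "h (free_bracket u v) = br (h u) (h v)" for u v k
  proof -
    obtain s t where "u = abs_free_lie s" "v = abs_free_lie t"
      using abs_ex by metis
    then show "h (u + v) = h u + h v" "h (free_scale k u) = sc k (h u)"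
      "h (free_bracket u v) = br (h u) (h v)"
      by (simp_all add: plus_free_lie.abs_eq free_scale.abs_eq free_bracket.abs_eq h_abs)
  qed
  show ?thesis
  proof (rule ex1I[of _ h])
    show "lie_hom free_scale free_bracket sc br h \<and> (\<forall>x. h (free_gen x) = f x)"
      using h_hom
      by (auto simp: lie_hom_def Vector_Spaces.linear_iff free_gen.abs_eq h_abs
          F.vector_space_axioms M.vector_space_axioms)
  next
    fix g assume g: "lie_hom free_scale free_bracket sc br g \<and> (\<forall>x. g (free_gen x) = f x)"
    then have g_hom: "g (u + v) = g u + g v" "g (free_scale k u) = sc k (g u)"
      "g (free_bracket u v) = br (g u) (g v)" "g (free_gen x) = f x" for u v k x
      by (auto simp: lie_hom_def Vector_Spaces.linear_iff)
    have "g (abs_free_lie s) = eval_expr sc br f s" for s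
    proof (induction s)
      case EZero
      have "g 0 + g 0 = g 0 + 0" using g_hom(1)[of 0 0] by simp
      then have "g 0 = 0" by (simp only: add_left_cancel)
      then show ?case by (simp add: zero_free_lie_def)
    qed (simp_all add: g_hom flip: free_gen.abs_eq plus_free_lie.abs_eq free_scale.abs_eq
        free_bracket.abs_eq)
    then show "g = h"
      using abs_ex h_abs by (metis ext)
  qed
qed


section \<open>Interpretation by equations\<close>

text \<open>
  Coefficients are elements of the algebra; scalars are not part of the language.  (In a free
  Lie algebra with distinct basis elements \<open>a\<close>, \<open>b\<close> this is no restriction: \<open>y = kx\<close> is equivalent to
  \<open>[y, a] = [x, ka]\<close> and \<open>[y, b] = [x, kb]\<close>.)  The variables with indices below \<open>m\<close> stand for \<open>x\<^sub>1, \<dots>, x\<^sub>m\<close>, and those with indices from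
  \<open>m\<close> to \<open>m + k - 1\<close> for \<open>y\<^sub>1, \<dots>, y\<^sub>k\<close>.
\<close>

datatype 'l rterm =
    Var nat
  | Const 'l
  | Plus "'l rterm" "'l rterm"
  | Neg "'l rterm"
  | Bracket "'l rterm" "'l rterm"

primrec rvars :: "'l rterm \<Rightarrow> nat set" where
  "rvars (Var i) = {i}"
| "rvars (Const c) = {}"
| "rvars (Plus s t) = rvars s \<union> rvars t"
| "rvars (Neg s) = rvars s"
| "rvars (Bracket s t) = rvars s \<union> rvars t"

primrec reval :: "('l::ab_group_add \<Rightarrow> 'l \<Rightarrow> 'l) \<Rightarrow> 'l list \<Rightarrow> 'l rterm \<Rightarrow> 'l" where
  "reval bracket vs (Var i) = vs ! i"
| "reval bracket vs (Const c) = c"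
| "reval bracket vs (Plus s t) = reval bracket vs s + reval bracket vs t"
| "reval bracket vs (Neg s) = - reval bracket vs s"
| "reval bracket vs (Bracket s t) = bracket (reval bracket vs s) (reval bracket vs t)"

definition e_definable ::
  "('l::ab_group_add \<Rightarrow> 'l \<Rightarrow> 'l) \<Rightarrow> nat \<Rightarrow> 'l list set \<Rightarrow> bool" where
  "e_definable bracket m X \<longleftrightarrow>
     X \<subseteq> {cs. length cs = m} \<and>
     (\<exists>k (S :: ('l rterm \<times> 'l rterm) set).
        finite S \<and>
        (\<forall>(s, t) \<in> S. rvars s \<union> rvars t \<subseteq> {..<m + k}) \<and>
        (\<forall>cs. length cs = m \<longrightarrow>
           (cs \<in> X \<longleftrightarrow>
             (\<exists>ys. length ys = k \<and> (\<forall>(s, t) \<in> S. reval bracket (cs @ ys) s = reval bracket (cs @ ys) t)))))"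

definition e_interpretation ::
  "('l::ab_group_add \<Rightarrow> 'l \<Rightarrow> 'l) \<Rightarrow> nat \<Rightarrow> 'l list set \<Rightarrow> ('l list \<Rightarrow> 'r::ring) \<Rightarrow> bool" where
  "e_interpretation bracket m X \<phi> \<longleftrightarrow>
     e_definable bracket m X \<and>
     \<phi> ` X = UNIV \<and>
     e_definable bracket (2 * m)
       {as @ bs | as bs. as \<in> X \<and> bs \<in> X \<and> \<phi> as = \<phi> bs} \<and>
     e_definable bracket (3 * m)
       {as @ bs @ cs | as bs cs. as \<in> X \<and> bs \<in> X \<and> cs \<in> X \<and> \<phi> as + \<phi> bs = \<phi> cs} \<and>
     e_definable bracket (3 * m)
       {as @ bs @ cs | as bs cs. as \<in> X \<and> bs \<in> X \<and> cs \<in> X \<and> \<phi> as * \<phi> bs = \<phi> cs}"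

definition e_interpretable ::
  "'r::ring itself \<Rightarrow> ('l::ab_group_add \<Rightarrow> 'l \<Rightarrow> 'l) \<Rightarrow> bool" where
  "e_interpretable _ bracket \<longleftrightarrow>
     (\<exists>m X (\<phi> :: 'l list \<Rightarrow> 'r). e_interpretation bracket m X \<phi>)"

end

theory Submission
  imports Defs "HOL-Library.Poly_Mapping"
begin

text \<open>
  Let \<open>a\<close>, \<open>b\<close>, \<open>c\<close> be distinct free generators of \<open>L\<close>, and write \<open>\<equiv>\<close> for congruence modulo \<open>[a, L]\<close>.
  A polynomial \<open>p\<close> is coded by \<open>u = p(ad a) b\<close>, up to multiples of \<open>a\<close>.  Since \<open>[[a, x], y] \<equiv> - [x, [a, y]]\<close>,
  one has \<open>[q(ad a) x, y] \<equiv> [x, q(- ad a) y]\<close>.  Hence, with \<open>v = - p(- ad a) c\<close>, one has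
  \<open>[u, c] + [b, v] \<equiv> 0\<close>; and if \<open>p\<close> is even then \<open>[u, b] \<equiv> 0\<close>, because
  \<open>[(ad a)\<^bsup>2m\<^esup> b, b] \<equiv> \<plusminus> [(ad a)\<^bsup>m\<^esup> b, (ad a)\<^bsup>m\<^esup> b] = 0\<close>, so that in general \<open>u = u\<^sub>0 + [a, u\<^sub>1]\<close> with
  \<open>[u\<^sub>0, b] \<equiv> [u\<^sub>1, b] \<equiv> 0\<close>, and likewise for \<open>v\<close> and \<open>c\<close>.

  Conversely these equations characterise the codes.  Expand everything in the free associative
  algebra.  By cyclic rotation of words, \<open>[u, b] \<equiv> 0\<close> forces all words of \<open>u\<close> to be words in \<open>a\<close>, \<open>b\<close>, and
  \<open>[u, c] + [b, v] \<equiv> 0\<close> says that the coefficient of \<open>a\<^sup>k b w\<close> in \<open>u\<close> is minus that of \<open>w c a\<^sup>k\<close> in \<open>v\<close>.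
  So \<open>u\<close> only has words with at most one \<open>b\<close>, and a Lie element of this kind is \<open>\<alpha> a + p(ad a) b\<close>.
  The map from \<open>L\<close> to the free associative algebra need not be known to be injective: as the adjoint
  representation factors through it, its kernel is central, and brackets do not see central summands.

  If \<open>u\<close>, \<open>w\<close> code \<open>p\<close>, \<open>r\<close> and \<open>v\<close> is paired with a code of \<open>q\<close>, then \<open>[u, v] \<equiv> - [(p q)(ad a) b, c]\<close>, so that
  \<open>r = p q\<close> is equivalent to \<open>[u, v] + [w, c] \<equiv> 0\<close>.
\<close>

section \<open>The free associative algebra\<close>

text \<open>With concatenation as addition, the convolution product of finitely supported functions
  on words is the product of the free associative algebra.\<close>

instantiation list :: (type) monoid_add
begin
definition zero_list :: "'a list" where "zero_list = []"
definition plus_list :: "'a list \<Rightarrow> 'a list \<Rightarrow> 'a list" where "plus_list = append"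
instance by standard (simp_all add: zero_list_def plus_list_def)
end

type_synonym ('x, 'k) free_assoc = "'x list \<Rightarrow>\<^sub>0 'k"

abbreviation coef :: "('x, 'k::zero) free_assoc \<Rightarrow> 'x list \<Rightarrow> 'k" where
  "coef \<equiv> Poly_Mapping.lookup"

definition letter :: "'x \<Rightarrow> ('x, 'k::field) free_assoc" where
  "letter x = Poly_Mapping.single [x] 1"

text \<open>Written as a product with a multiple of the empty word, so that
  \<open>ad_assoc_mult\<close> also covers scalars.\<close>

definition assoc_scale :: "'k::field \<Rightarrow> ('x, 'k) free_assoc \<Rightarrow> ('x, 'k) free_assoc" where
  "assoc_scale k f = Poly_Mapping.single [] k * f"

definition commutator :: "'a::ring \<Rightarrow> 'a \<Rightarrow> 'a" where
  "commutator f g = f * g - g * f"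

text \<open>A factorisation of \<open>w\<close> is determined by the length of its left part, so the
  convolution sum runs over the cut positions.\<close>

lemma coef_mult:
  fixes f g :: "('x, 'k::field) free_assoc"
  shows "coef (f * g) w = (\<Sum>i\<le>length w. coef f (take i w) * coef g (drop i w))"
proof -
  define h where "h l = coef f l * (\<Sum>q. coef g q when w = l + q)" for l
  have h: "h l = (if take (length l) w = l then coef f l * coef g (drop (length l) w) else 0)" for l
  proof (cases "take (length l) w = l")
    case True
    then have "w = l + q \<longleftrightarrow> q = drop (length l) w" for q
      by (auto simp: plus_list_def) (metis append_take_drop_id)
    then show ?thesis using True by (simp add: h_def)
  next
    case False
    then have "w \<noteq> l + q" for q by (auto simp: plus_list_def)
    then show ?thesis using False by (simp add: h_def)
  qed
  have "coef (f * g) w = Sum_any h"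
    by (simp add: lookup_mult h_def)
  also have "\<dots> = sum h ((\<lambda>i. take i w) ` {..length w})"
  proof (rule Sum_any.expand_superset)
    show "{l. h l \<noteq> 0} \<subseteq> (\<lambda>i. take i w) ` {..length w}"
    proof
      fix l assume "l \<in> {l. h l \<noteq> 0}"
      then have l: "take (length l) w = l" by (auto simp: h split: if_splits)
      then have "length l \<le> length w" by (metis length_take min.cobounded1)
      then show "l \<in> (\<lambda>i. take i w) ` {..length w}" using l by (metis atMost_iff imageI)
    qed
  qed simp
  also have "\<dots> = (\<Sum>i\<le>length w. h (take i w))"
    by (rule sum.reindex_cong[of "\<lambda>i. take i w"])
      (auto intro!: inj_onI dest: arg_cong[of _ _ length])
  also have "\<dots> = (\<Sum>i\<le>length w. coef f (take i w) * coef g (drop i w))"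
    by (rule sum.cong) (auto simp: h min_def)
  finally show ?thesis .
qed

lemma coef_letter: "coef (letter x) w = (if w = [x] then 1 else 0)"
  by (simp add: letter_def lookup_single)

lemma coef_assoc_scale [simp]: "coef (assoc_scale k f) w = k * coef f w"
proof -
  have "coef (assoc_scale k f) w = (\<Sum>i\<le>length w. if i = 0 then k * coef f w else 0)"
    unfolding assoc_scale_def coef_mult
    by (rule sum.cong) (auto simp: lookup_single when_def)
  then show ?thesis by simp
qed

lemma coef_letter_mult [simp]:
  "coef (letter x * f) [] = 0"
  "coef (letter x * f) (y # w) = (if y = x then coef f w else 0)"
proof -
  show "coef (letter x * f) [] = 0" by (simp add: coef_mult coef_letter)
  have "coef (letter x * f) (y # w) = (\<Sum>i\<le>Suc (length w). if i = 1 then (if y = x then coef f w else 0) else 0)"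
    unfolding coef_mult
    by (rule sum.cong) (auto simp: coef_letter take_Cons' split: if_splits)
  then show "coef (letter x * f) (y # w) = (if y = x then coef f w else 0)"
    by (simp del: sum.atMost_Suc)
qed

lemma coef_mult_letter [simp]:
  "coef (f * letter x) [] = 0"
  "coef (f * letter x) (w @ [y]) = (if y = x then coef f w else 0)"
proof -
  show "coef (f * letter x) [] = 0" by (simp add: coef_mult coef_letter)
  have "coef (f * letter x) (w @ [y]) = (\<Sum>i\<le>Suc (length w). if i = length w then (if y = x then coef f w else 0) else 0)"
    unfolding coef_mult
  proof (rule sum.cong)
    fix i assume "i \<in> {..Suc (length w)}"
    then consider "i < length w" | "i = length w" | "i = Suc (length w)" by fastforce
    then show "coef f (take i (w @ [y])) * coef (letter x) (drop i (w @ [y])) =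
        (if i = length w then if y = x then coef f w else 0 else 0)"
      by cases (auto simp: coef_letter drop_eq_Nil dest: arg_cong[of _ _ length])
  qed simp
  then show "coef (f * letter x) (w @ [y]) = (if y = x then coef f w else 0)" by simp
qed

lemma lie_algebra_commutator:
  "lie_algebra (assoc_scale :: 'k::field \<Rightarrow> ('x, 'k) free_assoc \<Rightarrow> _) commutator"
proof -
  have scale_left: "assoc_scale k x * y = assoc_scale k (x * y)"
    and scale_right: "x * assoc_scale k y = assoc_scale k (x * y)"
    for k :: 'k and x y :: "('x, 'k) free_assoc"
    by (rule poly_mapping_eqI, simp add: coef_mult sum_distrib_left ac_simps)+
  have scale_diff: "assoc_scale k (x - y) = assoc_scale k x - assoc_scale k y"
    for k :: 'k and x y :: "('x, 'k) free_assoc"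
    by (rule poly_mapping_eqI) (simp add: lookup_minus algebra_simps)
  show ?thesis
  proof
    fix k l :: 'k and x y z :: "('x, 'k) free_assoc"
    show "assoc_scale k (x + y) = assoc_scale k x + assoc_scale k y"
      by (rule poly_mapping_eqI) (simp add: lookup_add algebra_simps)
    show "assoc_scale (k + l) x = assoc_scale k x + assoc_scale l x"
      by (rule poly_mapping_eqI) (simp add: lookup_add algebra_simps)
    show "assoc_scale k (assoc_scale l x) = assoc_scale (k * l) x"
      by (rule poly_mapping_eqI) simp
    show "assoc_scale 1 x = x"
      by (rule poly_mapping_eqI) simp
    show "commutator (assoc_scale k x) y = assoc_scale k (commutator x y)"
      and "commutator x (assoc_scale k y) = assoc_scale k (commutator x y)"
      by (simp_all add: commutator_def scale_left scale_right scale_diff)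
  qed (simp_all add: commutator_def algebra_simps)
qed

lemma free_assoc_induct [case_names zero monomial add]:
  assumes "P 0" and "\<And>w k. P (Poly_Mapping.single w k)" and "\<And>f g. P f \<Longrightarrow> P g \<Longrightarrow> P (f + g)"
  shows "P (f :: 'a \<Rightarrow>\<^sub>0 'b::monoid_add)"
proof (induction f rule: update_induct)
  case const
  then show ?case by (rule assms(1))
next
  case (update f a b)
  have "Poly_Mapping.update a b f = f + Poly_Mapping.single a b"
    using update(1) by (intro poly_mapping_eqI) (auto simp: lookup_update lookup_add lookup_single when_def in_keys_iff)
  then show ?case using update assms by simp
qed

section \<open>Cyclic rotation of words\<close>

lemma coef_mult_letter_last:
  "coef (f * letter x) w = (if w \<noteq> [] \<and> last w = x then coef f (butlast w) else 0)"
  by (cases w rule: rev_cases) simp_all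

text \<open>Comparing coefficients at words ending in \<open>b\<close> or \<open>a\<close> replaces
  a word by one with its first letter removed and \<open>b\<close> or \<open>a\<close> appended.
  Thus a letter outside \<open>{a, b}\<close> moves to the front, where the coefficient is
  0.\<close>

lemma rotation_support:
  fixes U W :: "('x, 'k::field) free_assoc"
  assumes eq: "commutator U (letter b) = commutator (letter a) W" and ab: "a \<noteq> b"
    and w: "\<not> set w \<subseteq> {a, b}"
  shows "coef U w = 0"
proof -
  have E: "coef (U * letter b) z - coef (letter b * U) z = coef (letter a * W) z - coef (W * letter a) z" for z
    using arg_cong[OF eq, of "\<lambda>f. coef f z"] by (simp add: commutator_def lookup_minus)
  \<comment> \<open>\<open>W\<close> is included because a first letter \<open>a\<close> leads from
    \<open>U\<close> to \<open>W\<close>, and a first letter \<open>b\<close> from \<open>W\<close>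
    to \<open>U\<close>.\<close>
  have "coef U (w1 @ y # w2) = 0 \<and> coef W (w1 @ y # w2) = 0" if y: "y \<notin> {a, b}" for w1 y w2
  proof (induction w1 arbitrary: w2)
    case Nil
    show ?case
      using E[of "y # w2 @ [b]"] E[of "y # w2 @ [a]"] y ab
      by (auto simp: coef_mult_letter_last butlast_append)
  next
    case (Cons x w1)
    show ?case
      using E[of "x # w1 @ y # w2 @ [b]"] E[of "x # w1 @ y # w2 @ [a]"]
        Cons.IH[of "w2 @ [b]"] Cons.IH[of "w2 @ [a]"] ab
      by (auto simp: coef_mult_letter_last butlast_append split: if_splits)
  qed
  moreover obtain w1 y w2 where "w = w1 @ y # w2" "y \<notin> {a, b}"
    using w by (metis split_list subsetI)
  ultimately show ?thesis by simp
qed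

text \<open>At a word from \<open>b\<close> to \<open>c\<close> the equation compares
  \<open>U\<close> and \<open>V\<close> directly; leading letters \<open>a\<close> are first carried
  to the other end through \<open>W\<close>.\<close>

lemma rotation_transfer:
  fixes U V W :: "('x, 'k::field) free_assoc"
  assumes eq: "commutator U (letter c) + commutator (letter b) V = commutator (letter a) W"
    and abc: "a \<noteq> b" "a \<noteq> c" "b \<noteq> c"
  shows "coef U (replicate k a @ b # w) = - coef V (w @ c # replicate k a)"
proof -
  have E: "coef (U * letter c) z - coef (letter c * U) z + coef (letter b * V) z - coef (V * letter b) z
      = coef (letter a * W) z - coef (W * letter a) z" for z
    using arg_cong[OF eq, of "\<lambda>f. coef f z"]
    by (simp add: commutator_def lookup_minus lookup_add add_diff_eq)
  \<comment> \<open>At words that start and end with \<open>a\<close> only \<open>W\<close>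
    contributes, so each leading \<open>a\<close> moves to the end; once \<open>b\<close> comes
    first, \<open>V\<close> takes over.\<close>
  have W: "coef W (replicate k a @ b # w @ c # replicate j a)
      = - coef V (w @ c # replicate (Suc (k + j)) a)" for j k
  proof (induction k arbitrary: j)
    case 0
    show ?case
      using E[of "b # w @ c # replicate j a @ [a]"] abc
      by (auto simp: coef_mult_letter_last butlast_append simp flip: replicate_append_same)
  next
    case (Suc k)
    have "coef W (a # replicate k a @ b # w @ c # replicate j a)
        = coef W (replicate k a @ b # w @ c # replicate j a @ [a])"
      using E[of "a # replicate k a @ b # w @ c # replicate j a @ [a]"] abc
      by (auto simp: coef_mult_letter_last butlast_append)
    also have "\<dots> = - coef V (w @ c # replicate (Suc (k + Suc j)) a)"
      using Suc.IH[of "Suc j"] by (simp add: replicate_append_same)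
    finally show ?case by simp
  qed
  show ?thesis
  proof (cases k)
    case 0
    then show ?thesis
      using E[of "b # w @ [c]"] abc by (auto simp: coef_mult_letter_last butlast_append eq_neg_iff_add_eq_0)
  next
    case (Suc j)
    then show ?thesis
      using E[of "a # replicate j a @ b # w @ [c]"] W[of j 0] abc
      by (auto simp: coef_mult_letter_last butlast_append)
  qed
qed

section \<open>Polynomials in an inner derivation\<close>

context lie_algebra
begin

lemma bracket_zero_left [simp]: "bracket 0 y = 0"
  using bracket_add_left[of 0 0 y] by simp

lemma bracket_zero_right [simp]: "bracket x 0 = 0"
  using bracket_add_right[of x 0 0] by simp

lemma bracket_minus_left [simp]: "bracket (- x) y = - bracket x y"
  using bracket_add_left[of x "- x" y] by (simp add: eq_neg_iff_add_eq_0 add.commute)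

lemma bracket_minus_right [simp]: "bracket x (- y) = - bracket x y"
  using bracket_add_right[of x y "- y"] by (simp add: eq_neg_iff_add_eq_0 add.commute)

lemma bracket_diff_left: "bracket (x - y) z = bracket x z - bracket y z"
  using bracket_add_left[of x "- y" z] by simp

lemma bracket_diff_right: "bracket x (y - z) = bracket x y - bracket x z"
  using bracket_add_right[of x y "- z"] by simp

lemmas bracket_bilinear = bracket_add_left bracket_add_right bracket_diff_left bracket_diff_right
  bracket_scale_left bracket_scale_right

lemma bracket_swap: "bracket x y = - bracket y x"
proof -
  have "0 = bracket (x + y) (x + y)" by (simp only: bracket_self)
  also have "\<dots> = bracket x x + bracket y x + (bracket x y + bracket y y)"
    by (simp only: bracket_add_left bracket_add_right)
  finally show ?thesis by (simp add: bracket_self eq_neg_iff_add_eq_0 add.commute)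
qed

lemma bracket_derivation: "bracket z (bracket x y) = bracket (bracket z x) y + bracket x (bracket z y)"
proof -
  have "bracket x (bracket y z) = - bracket x (bracket z y)"
    by (simp add: bracket_swap[of y z])
  then show ?thesis
    using jacobi[of z x y] bracket_swap[of y "bracket z x"]
    by (simp add: add_eq_0_iff algebra_simps)
qed

lemma bracket_bracket: "bracket (bracket x y) z = bracket x (bracket y z) - bracket y (bracket x z)"
  using bracket_derivation[of x y z] by simp

section \<open>Congruence modulo the image of an inner derivation\<close>

lemma range_ad_add: "x \<in> range (bracket z) \<Longrightarrow> y \<in> range (bracket z) \<Longrightarrow> x + y \<in> range (bracket z)"
  by (auto simp flip: bracket_add_right)

lemma range_ad_diff: "x \<in> range (bracket z) \<Longrightarrow> y \<in> range (bracket z) \<Longrightarrow> x - y \<in> range (bracket z)"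
  by (auto simp flip: bracket_diff_right)

lemma range_ad_minus: "x \<in> range (bracket z) \<Longrightarrow> - x \<in> range (bracket z)"
  by (auto simp flip: bracket_minus_right)

lemma range_ad_scale: "x \<in> range (bracket z) \<Longrightarrow> scale k x \<in> range (bracket z)"
  by (auto simp flip: bracket_scale_right)

lemma range_ad_zero: "0 \<in> range (bracket z)"
  using rangeI[of "bracket z" 0] by simp

lemma range_ad_skew:
  "bracket (bracket z x) y \<in> range (bracket z) \<longleftrightarrow> bracket x (bracket z y) \<in> range (bracket z)"
proof -
  have "bracket (bracket z x) y = bracket z (bracket x y) - bracket x (bracket z y)"
    and "bracket x (bracket z y) = bracket z (bracket x y) - bracket (bracket z x) y"
    using bracket_derivation[of z x y] by simp_all
  then show ?thesis by (metis range_ad_diff rangeI)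
qed

text \<open>\<open>act z p x\<close> is \<open>p(ad z) x\<close>.\<close>

definition act :: "'l \<Rightarrow> 'k poly \<Rightarrow> 'l \<Rightarrow> 'l" where
  "act z p x = fold_coeffs (\<lambda>k y. scale k x + bracket z y) p 0"

lemma act_0 [simp]: "act z 0 x = 0"
  by (simp add: act_def)

lemma act_pCons [simp]: "act z (pCons k p) x = scale k x + bracket z (act z p x)"
  by (cases "p = 0 \<and> k = 0") (auto simp: act_def)

lemma act_add: "act z (p + q) x = act z p x + act z q x"
  by (induction p q rule: poly_induct2) (simp_all add: bracket_bilinear scale_left_distrib algebra_simps)

lemma act_smult: "act z (smult k p) x = scale k (act z p x)"
  by (induction p) (simp_all add: bracket_bilinear scale_right_distrib)

lemma act_diff: "act z (p - q) x = act z p x - act z q x"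
  using act_add[of z "p - q" q x] by simp

lemma act_mult: "act z (p * q) x = act z p (act z q x)"
  by (induction p) (simp_all add: act_add act_smult)

lemma act_bracket: "act z p (bracket z x) = bracket z (act z p x)"
  by (induction p) (simp_all add: bracket_bilinear)

lemma act_minus_right: "act z p (- x) = - act z p x"
  by (induction p) simp_all

text \<open>Modulo \<open>range (bracket z)\<close> the adjoint of ad z for the pairing
  \<open>bracket\<close> is - ad z, by the Leibniz rule. In the induction \<open>y\<close> is free
  to absorb a \<open>bracket z\<close>.\<close>

lemma act_adjoint:
  "bracket (act z p x) y - bracket x (act (- z) p y) \<in> range (bracket z)"
proof (induction p arbitrary: y)
  case 0
  then show ?case by (simp add: range_ad_zero)
next
  case (pCons k p)
  have "bracket (act z (pCons k p) x) y - bracket x (act (- z) (pCons k p) y)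
      = bracket z (bracket (act z p x) y)
        - (bracket (act z p x) (bracket z y) - bracket x (act (- z) p (bracket z y)))"
    using act_bracket[of "- z" p y]
    by (simp add: bracket_bilinear bracket_derivation[of z "act z p x" y] act_minus_right)
  then show ?case
    using pCons.IH[of "bracket z y"] by (simp add: range_ad_diff)
qed

text \<open>Orthogonality to \<open>x\<close> for the pairing \<open>bracket\<close> modulo
  \<open>range (bracket z)\<close>.\<close>

definition orth :: "'l \<Rightarrow> 'l \<Rightarrow> 'l set" where
  "orth z x = {u. bracket u x \<in> range (bracket z)}"

text \<open>
  The splitting \<open>u + [z, v]\<close> makes room for odd polynomials: in general \<open>orth z x\<close> contains \<open>p(ad z) x\<close> only for even \<open>p\<close>.
\<close>

definition poly_hull :: "'l \<Rightarrow> 'l \<Rightarrow> 'l set" where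
  "poly_hull z x = {u + bracket z v | u v. u \<in> orth z x \<and> v \<in> orth z x}"

lemma orth_zero: "0 \<in> orth z x"
  by (simp add: orth_def range_ad_zero)

lemma poly_hull_add:
  assumes "u \<in> poly_hull z x" "v \<in> poly_hull z x" shows "u + v \<in> poly_hull z x"
proof -
  obtain u0 u1 v0 v1 where "u = u0 + bracket z u1" "v = v0 + bracket z v1"
    "u0 \<in> orth z x" "u1 \<in> orth z x" "v0 \<in> orth z x" "v1 \<in> orth z x"
    using assms by (auto simp: poly_hull_def)
  then have "u + v = (u0 + v0) + bracket z (u1 + v1)" "u0 + v0 \<in> orth z x" "u1 + v1 \<in> orth z x"
    by (simp_all add: bracket_bilinear orth_def range_ad_add algebra_simps)
  then show ?thesis unfolding poly_hull_def by blast
qed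

lemma poly_hull_scale:
  assumes "u \<in> poly_hull z x" shows "scale k u \<in> poly_hull z x"
proof -
  obtain u0 u1 where "u = u0 + bracket z u1" "u0 \<in> orth z x" "u1 \<in> orth z x"
    using assms by (auto simp: poly_hull_def)
  then have "scale k u = scale k u0 + bracket z (scale k u1)" "scale k u0 \<in> orth z x" "scale k u1 \<in> orth z x"
    by (simp_all add: bracket_bilinear orth_def range_ad_scale scale_right_distrib)
  then show ?thesis unfolding poly_hull_def by blast
qed

lemma poly_hull_minus: "u \<in> poly_hull z x \<Longrightarrow> - u \<in> poly_hull z x"
  using poly_hull_scale[of u z x "- 1"] by simp

lemma poly_hull_diff: "u \<in> poly_hull z x \<Longrightarrow> v \<in> poly_hull z x \<Longrightarrow> u - v \<in> poly_hull z x"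
  using poly_hull_add[of u z x "- v"] poly_hull_minus by simp

lemma orth_subset_poly_hull: "orth z x \<subseteq> poly_hull z x"
  using orth_zero[of z x] by (auto simp: poly_hull_def) (metis add.right_neutral bracket_zero_right)

lemma bracket_orth_subset_poly_hull: "u \<in> orth z x \<Longrightarrow> bracket z u \<in> poly_hull z x"
  using orth_zero[of z x] by (auto simp: poly_hull_def) (metis add.left_neutral)

text \<open>Moving one \<open>bracket z\<close> from the left argument to the right lowers the gap
  between the exponents by two; at gap 0 \<open>bracket_self\<close> applies.\<close>

lemma bracket_power_even:
  "bracket ((bracket z ^^ (i + 2 * m)) x) ((bracket z ^^ i) x) \<in> range (bracket z)"
proof (induction m arbitrary: i)
  case 0
  then show ?case by (simp add: bracket_self range_ad_zero)
next
  case (Suc m)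
  show ?case
    using Suc.IH[of "Suc i"] by (simp add: range_ad_skew)
qed

text \<open>Even powers lie in \<open>orth\<close>, and an odd power is \<open>bracket z\<close> of
  an even one: these are the two summands of the hull.\<close>

lemma power_in_poly_hull: "(bracket z ^^ n) x \<in> poly_hull z x"
proof -
  have even: "(bracket z ^^ (2 * m)) x \<in> orth z x" for m
    using bracket_power_even[where i = 0] by (simp add: orth_def)
  show ?thesis
  proof (cases "even n")
    case True
    then show ?thesis using even orth_subset_poly_hull by (auto elim!: evenE)
  next
    case False
    then show ?thesis using even bracket_orth_subset_poly_hull by (auto elim!: oddE)
  qed
qed

lemma act_in_poly_hull: "act z p x \<in> poly_hull z x"
proof -
  \<comment> \<open>All powers are treated at once, since \<open>act_bracket\<close> pushes the
    \<open>bracket z\<close> of a \<open>pCons\<close> into the argument.\<close>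
  have "act z p ((bracket z ^^ n) x) \<in> poly_hull z x" for n
  proof (induction p arbitrary: n)
    case 0
    then show ?case using orth_zero[of z x] orth_subset_poly_hull[of z x] by auto
  next
    case (pCons k p)
    show ?case
      using pCons.IH[of "Suc n"]
      by (auto simp: act_bracket intro: poly_hull_add poly_hull_scale power_in_poly_hull)
  qed
  from this[of 0] show ?thesis by simp
qed

lemma orth_minus_left: "orth (- z) x = orth z x"
proof -
  have "range (bracket (- z)) = range (bracket z)"
    using rangeI[of "bracket z" "- y" for y] rangeI[of "bracket (- z)" "- y" for y] by auto
  then show ?thesis by (simp add: orth_def)
qed

text \<open>For the second member of a pair, which is a polynomial in ad (- z).\<close>

lemma poly_hull_minus_left: "poly_hull (- z) x = poly_hull z x"
proof -
  have "- u \<in> orth z x" if "u \<in> orth z x" for u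
    using that by (simp add: orth_def range_ad_minus)
  then show ?thesis
    by (auto simp: poly_hull_def orth_minus_left) (metis bracket_minus_right minus_minus add_uminus_conv_diff diff_conv_add_uminus)+
qed

end

section \<open>Expansion in the free associative algebra\<close>

text \<open>\<open>rep\<close> expands Lie elements into words; \<open>generated\<close> says, as an
  induction rule, that \<open>basis\<close> generates the algebra.\<close>

locale free_lie_rep = lie_algebra scale bracket
  for scale :: "'k::field \<Rightarrow> 'l::ab_group_add \<Rightarrow> 'l" and bracket :: "'l \<Rightarrow> 'l \<Rightarrow> 'l" +
  fixes basis :: "'x \<Rightarrow> 'l" and rep :: "'l \<Rightarrow> ('x, 'k) free_assoc"
  assumes rep_add: "rep (u + v) = rep u + rep v"
    and rep_scale: "rep (scale k u) = assoc_scale k (rep u)"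
    and rep_bracket: "rep (bracket u v) = commutator (rep u) (rep v)"
    and rep_basis: "rep (basis x) = letter x"
    and generated: "\<And>P u. (\<And>x. P (basis x)) \<Longrightarrow> P 0 \<Longrightarrow> (\<And>u v. P u \<Longrightarrow> P v \<Longrightarrow> P (u + v)) \<Longrightarrow>
      (\<And>k u. P u \<Longrightarrow> P (scale k u)) \<Longrightarrow> (\<And>u v. P u \<Longrightarrow> P v \<Longrightarrow> P (bracket u v)) \<Longrightarrow> P u"
begin

lemma rep_0 [simp]: "rep 0 = 0"
  using rep_add[of 0 0] by simp

lemma rep_minus: "rep (- u) = - rep u"
  using rep_add[of u "- u"] by (simp add: eq_neg_iff_add_eq_0 add.commute)

lemma rep_diff: "rep (u - v) = rep u - rep v"
  using rep_add[of u "- v"] by (simp add: rep_minus)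

section \<open>The adjoint action of the free associative algebra\<close>

definition ad_word :: "'x list \<Rightarrow> 'l \<Rightarrow> 'l" where
  "ad_word w y = foldr (\<lambda>x. bracket (basis x)) w y"

definition ad_assoc :: "('x, 'k) free_assoc \<Rightarrow> 'l \<Rightarrow> 'l" where
  "ad_assoc f y = (\<Sum>w\<in>Poly_Mapping.keys f. scale (coef f w) (ad_word w y))"

lemma ad_word_add: "ad_word w (y + z) = ad_word w y + ad_word w z"
  by (induction w) (simp_all add: ad_word_def bracket_bilinear)

lemma ad_word_scale: "ad_word w (scale k y) = scale k (ad_word w y)"
  by (induction w) (simp_all add: ad_word_def bracket_bilinear)

lemma ad_assoc_0 [simp]: "ad_assoc 0 y = 0"
  by (simp add: ad_assoc_def)

lemma ad_assoc_single: "ad_assoc (Poly_Mapping.single w k) y = scale k (ad_word w y)"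
  by (simp add: ad_assoc_def)

lemma ad_assoc_add: "ad_assoc (f + g) y = ad_assoc f y + ad_assoc g y"
  unfolding ad_assoc_def
  by (rule setsum_keys_plus_distrib) (simp_all add: scale_left_distrib)

lemma ad_assoc_diff: "ad_assoc (f - g) y = ad_assoc f y - ad_assoc g y"
  using ad_assoc_add[of "f - g" g y] by simp

text \<open>The leftmost letter of a word acts last in \<open>ad_word\<close>, so concatenation
  becomes composition.\<close>

lemma ad_assoc_mult: "ad_assoc (f * g) y = ad_assoc f (ad_assoc g y)"
proof (induction f rule: free_assoc_induct)
  case (monomial w k)
  show ?case
  proof (induction g rule: free_assoc_induct)
    case zero
    show ?case using ad_word_scale[of w 0 0] by (simp add: ad_assoc_single)
  next
    case (monomial w' k')
    show ?case
      by (simp add: mult_single ad_assoc_single ad_word_scale) (simp add: ad_word_def plus_list_def)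
  next
    case (add g h)
    then show ?case
      by (simp add: distrib_left ad_assoc_add ad_assoc_single ad_word_add scale_right_distrib)
  qed
qed (simp_all add: distrib_right ad_assoc_add)

text \<open>The adjoint representation factors through \<open>rep\<close>: by the Jacobi identity,
  ad of a bracket is the commutator of the two ads.\<close>

lemma bracket_eq_ad_assoc: "bracket u y = ad_assoc (rep u) y"
proof (induction u arbitrary: y rule: generated)
  case (1 x)
  show ?case by (simp add: rep_basis letter_def ad_assoc_single) (simp add: ad_word_def)
next
  case (4 k u)
  then show ?case
    by (simp add: rep_scale assoc_scale_def ad_assoc_mult ad_assoc_single bracket_bilinear)
       (simp add: ad_word_def)
next
  case (5 u v)
  show ?case
    unfolding bracket_bracket rep_bracket commutator_def ad_assoc_diff ad_assoc_mult
    by (simp only: 5)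
qed (simp_all add: rep_add ad_assoc_add bracket_bilinear)

lemma bracket_cong_rep: "rep u = rep v \<Longrightarrow> bracket u y = bracket v y"
  by (simp add: bracket_eq_ad_assoc)

end

section \<open>Pairs attached to one polynomial\<close>

context lie_algebra
begin

text \<open>The intended solutions are p(ad z) x and - p(- ad z) y with one common polynomial p; the
  last condition links the two.\<close>

definition poly_pair :: "'l \<Rightarrow> 'l \<Rightarrow> 'l \<Rightarrow> 'l \<Rightarrow> 'l \<Rightarrow> bool" where
  "poly_pair z x y u v \<longleftrightarrow>
     u \<in> poly_hull z x \<and> v \<in> poly_hull z y \<and> bracket u y + bracket x v \<in> range (bracket z)"

text \<open>The sign of the second member turns the difference in \<open>act_adjoint\<close> into
  the required sum.\<close>

lemma poly_pair_act: "poly_pair z x y (act z p x) (- act (- z) p y)"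
  using act_in_poly_hull[of z p x] act_in_poly_hull[of "- z" p y] act_adjoint[of z p x y]
  by (simp add: poly_pair_def poly_hull_minus_left poly_hull_minus)

lemma poly_pair_add:
  assumes "poly_pair z x y u v" "poly_pair z x y u' v'"
  shows "poly_pair z x y (u + u') (v + v')"
proof -
  have "bracket (u + u') y + bracket x (v + v')
      = (bracket u y + bracket x v) + (bracket u' y + bracket x v')"
    by (simp add: bracket_bilinear)
  then show ?thesis
    using assms range_ad_add unfolding poly_pair_def by (metis poly_hull_add)
qed

lemma poly_pair_diff:
  assumes "poly_pair z x y u v" "poly_pair z x y u' v'"
  shows "poly_pair z x y (u - u') (v - v')"
proof -
  have "bracket (u - u') y + bracket x (v - v')
      = (bracket u y + bracket x v) - (bracket u' y + bracket x v')"
    by (simp add: bracket_bilinear)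
  then show ?thesis
    using assms range_ad_diff unfolding poly_pair_def by (metis poly_hull_diff)
qed

end

context free_lie_rep
begin

lemma poly_hull_support:
  assumes u: "u \<in> poly_hull (basis a) (basis x)" and ax: "a \<noteq> x" and w: "\<not> set w \<subseteq> {a, x}"
  shows "coef (rep u) w = 0"
proof -
  obtain u0 u1 where u: "u = u0 + bracket (basis a) u1"
    and orth: "u0 \<in> orth (basis a) (basis x)" "u1 \<in> orth (basis a) (basis x)"
    using u by (auto simp: poly_hull_def)
  have supp: "coef (rep v) w' = 0"
    if "v \<in> orth (basis a) (basis x)" "\<not> set w' \<subseteq> {a, x}" for v w'
  proof -
    obtain y where "bracket v (basis x) = bracket (basis a) y"
      using \<open>v \<in> _\<close> by (auto simp: orth_def)
    then have "commutator (rep v) (letter x) = commutator (letter a) (rep y)"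
      using rep_bracket rep_basis by metis
    then show ?thesis using rotation_support ax that(2) by metis
  qed
  \<comment> \<open>Multiplying by \<open>letter a\<close> only adds an \<open>a\<close> at one end,
    so a foreign letter stays in the rest of the word.\<close>
  have "coef (letter a * rep u1) w = 0"
    using w supp[OF orth(2)] by (cases w) auto
  moreover have "coef (rep u1 * letter a) w = 0"
    using w supp[OF orth(2)] by (cases w rule: rev_cases) auto
  ultimately show ?thesis
    using supp[OF orth(1) w]
    by (simp add: u rep_add rep_bracket rep_basis commutator_def lookup_add lookup_minus)
qed

section \<open>Lie elements of degree at most one in a letter\<close>

lemma coef_act:
  assumes "a \<noteq> x"
  shows "coef (rep (act (basis a) p (basis x))) (replicate n a @ [x]) = coeff p n"
proof (induction p arbitrary: n)
  case (pCons k p)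
  \<comment> \<open>Of the two products in the commutator with \<open>letter a\<close>, only the one
    with \<open>a\<close> in front has words ending in \<open>x\<close>.\<close>
  then show ?case using assms
    by (cases n) (simp_all add: rep_add rep_scale rep_bracket rep_basis lookup_add lookup_minus commutator_def
        coef_letter coef_mult_letter_last)
qed simp

lemma coef_act_no_letter:
  assumes "a \<noteq> x" "x \<notin> set w"
  shows "coef (rep (act (basis a) p (basis x))) w = 0"
  using assms(2)
proof (induction p arbitrary: w)
  case (pCons k p)
  have "coef (letter a * rep (act (basis a) p (basis x))) w = 0"
    using pCons by (cases w) auto
  moreover have "coef (rep (act (basis a) p (basis x)) * letter a) w = 0"
    using pCons by (cases w rule: rev_cases) auto
  ultimately show ?case using pCons.prems
    by (auto simp: rep_add rep_scale rep_bracket rep_basis lookup_add lookup_minus commutator_def coef_letter)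
qed simp

text \<open>Factors of a word with at most one \<open>x\<close> again have at most one
  \<open>x\<close>, so on such words a bracket depends only on the corresponding parts of its
  arguments.\<close>

lemma linear_part:
  assumes ax: "a \<noteq> x"
  shows "\<exists>k p. \<forall>w. set w \<subseteq> {a, x} \<longrightarrow> count_list w x \<le> 1 \<longrightarrow>
    coef (rep u) w = coef (rep (scale k (basis a) + act (basis a) p (basis x))) w"
    (is "\<exists>k p. ?P u k p")
proof (induction u rule: generated)
  case (1 y)
  consider "y = a" | "y = x" | "y \<notin> {a, x}" by auto
  then show ?case
  proof cases
    case 1
    have "?P (basis y) 1 0" using 1 by simp
    then show ?thesis by blast
  next
    case 2
    have "?P (basis y) 0 1" using 2 by (simp add: one_pCons)
    then show ?thesis by blast
  next
    case 3
    have "?P (basis y) 0 0" using 3 by (auto simp: rep_basis coef_letter)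
    then show ?thesis by blast
  qed
next
  case 2
  have "?P 0 0 0" by simp
  then show ?case by blast
next
  case (3 u v)
  then obtain k p l q where "?P u k p" "?P v l q" by blast
  then have "?P (u + v) (k + l) (p + q)"
    by (simp add: rep_add lookup_add act_add scale_left_distrib)
  then show ?case by blast
next
  case (4 l u)
  then obtain k p where "?P u k p" by blast
  then have "?P (scale l u) (l * k) (smult l p)"
    by (simp add: rep_scale rep_add lookup_add act_smult algebra_simps)
  then show ?case by blast
next
  case (5 u v)
  then obtain k p l q where u: "?P u k p" and v: "?P v l q" by blast
  let ?p = "act (basis a) p (basis x)" and ?q = "act (basis a) q (basis x)"
  let ?u = "scale k (basis a) + ?p" and ?v = "scale l (basis a) + ?q"
  \<comment> \<open>The mixed terms k [a, q(ad a) x] and - l [a, p(ad a) x]; \<open>pCons 0\<close>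
    supplies the outer ad a.\<close>
  let ?r = "pCons 0 (smult k q - smult l p)"
  have "?P (bracket u v) 0 ?r"
  proof (intro allI impI)
    fix w assume w: "set w \<subseteq> {a, x}" "count_list w x \<le> 1"
    have cnt: "count_list w x = count_list (take i w) x + count_list (drop i w) x" for i
      by (metis append_take_drop_id count_list_append)
    have factor: "set (take i w) \<subseteq> {a, x}" "count_list (take i w) x \<le> 1"
      "set (drop i w) \<subseteq> {a, x}" "count_list (drop i w) x \<le> 1" for i
      using w cnt[of i] set_take_subset[of i w] set_drop_subset[of i w] by auto
    have "coef (rep u * rep v) w = coef (rep ?u * rep ?v) w"
      and "coef (rep v * rep u) w = coef (rep ?v * rep ?u) w"
      unfolding coef_mult using u v factor by (auto intro!: sum.cong)
    then have "coef (rep (bracket u v)) w = coef (rep (bracket ?u ?v)) w"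
      by (simp only: rep_bracket commutator_def lookup_minus)
    also have "bracket ?u ?v = act (basis a) ?r (basis x) + bracket ?p ?q"
      by (simp add: bracket_bilinear bracket_self act_diff act_smult scale_right_distrib
          bracket_swap[of _ "basis a"] algebra_simps)
    also have "coef (rep (\<dots>)) w = coef (rep (act (basis a) ?r (basis x))) w"
    proof -
      \<comment> \<open>Every word of either factor contains \<open>x\<close>, so every word of the
        product contains it twice.\<close>
      have no: "coef (rep (act (basis a) p (basis x)) * rep (act (basis a) q (basis x))) w = 0" for p q
        unfolding coef_mult
      proof (intro sum.neutral ballI)
        fix i
        have "x \<notin> set (take i w) \<or> x \<notin> set (drop i w)"
          using w(2) cnt[of i] count_list_0_iff[of "take i w" x] count_list_0_iff[of "drop i w" x]
          by linarith
        then show "coef (rep (act (basis a) p (basis x))) (take i w) *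
            coef (rep (act (basis a) q (basis x))) (drop i w) = 0"
          using coef_act_no_letter[OF ax] by auto
      qed
      show ?thesis
        by (simp only: rep_add lookup_add rep_bracket commutator_def lookup_minus no) simp
    qed
    finally show "coef (rep (bracket u v)) w =
        coef (rep (scale 0 (basis a) + act (basis a) ?r (basis x))) w"
      by simp
  qed
  then show ?case by blast
qed

text \<open>The multiples of a generator, up to the (central) kernel of \<open>rep\<close>.\<close>

definition line :: "'x \<Rightarrow> 'l set" where
  "line a = {u. \<exists>k. rep u = assoc_scale k (letter a)}"

text \<open>Elements with the same image under \<open>rep\<close> have the same brackets, so
  \<open>u\<close> acts like a multiple of \<open>basis a\<close>.\<close>

lemma line_bracket:
  assumes "u \<in> line a"
  obtains k where "\<And>y. bracket u y = scale k (bracket (basis a) y)"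
proof -
  obtain k where "rep u = rep (scale k (basis a))"
    using assms by (auto simp: line_def rep_scale rep_basis)
  then show thesis
    using that bracket_cong_rep bracket_scale_left by metis
qed

lemma line_scale_basis: "scale k (basis a) \<in> line a"
  by (auto simp: line_def rep_scale rep_basis)

lemma line_kernel: "rep u = 0 \<Longrightarrow> u \<in> line a"
  unfolding line_def by (auto intro!: exI[of _ 0] poly_mapping_eqI)

lemma line_add: "u \<in> line a \<Longrightarrow> v \<in> line a \<Longrightarrow> u + v \<in> line a"
  and line_diff: "u \<in> line a \<Longrightarrow> v \<in> line a \<Longrightarrow> u - v \<in> line a"
proof -
  have "assoc_scale k (letter a) + assoc_scale l (letter a) = assoc_scale (k + l) (letter a)"
    "assoc_scale k (letter a) - assoc_scale l (letter a) = assoc_scale (k - l) (letter a)" for k l :: 'k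
    by (rule poly_mapping_eqI, simp add: lookup_add lookup_minus algebra_simps)+
  then show "u \<in> line a \<Longrightarrow> v \<in> line a \<Longrightarrow> u + v \<in> line a"
    and "u \<in> line a \<Longrightarrow> v \<in> line a \<Longrightarrow> u - v \<in> line a"
    by (auto simp: line_def rep_add rep_diff)
qed

lemma line_bracket_in_range: "u \<in> line a \<Longrightarrow> bracket u y \<in> range (bracket (basis a))"
  by (metis line_bracket range_ad_scale rangeI)

lemma line_bracket_in_range': "u \<in> line a \<Longrightarrow> bracket y u \<in> range (bracket (basis a))"
  using line_bracket_in_range[of u a y] range_ad_minus bracket_swap[of y u] by metis

lemma line_bracket_basis: "u \<in> line a \<Longrightarrow> bracket u (basis a) = 0"
  by (metis line_bracket bracket_self scale_zero_right)

text \<open>Members of \<open>line a\<close> bracket into \<open>range (bracket (basis a))\<close>;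
  hence pairs are determined at best modulo \<open>line a\<close>.\<close>

lemma line_poly_pair:
  assumes "u \<in> line a" "v \<in> line a"
  shows "poly_pair (basis a) x y u v"
  using assms orth_subset_poly_hull[of "basis a"]
  by (auto simp: poly_pair_def orth_def subset_iff
      intro: range_ad_add line_bracket_in_range line_bracket_in_range')

lemma act_in_line_iff: "a \<noteq> x \<Longrightarrow> act (basis a) p (basis x) \<in> line a \<longleftrightarrow> p = 0"
proof
  assume ax: "a \<noteq> x" and "act (basis a) p (basis x) \<in> line a"
  then obtain k where "rep (act (basis a) p (basis x)) = assoc_scale k (letter a)"
    by (auto simp: line_def)
  then have "coeff p n = 0" for n
    using coef_act[OF ax, of p n] ax by (simp add: coef_letter append_eq_Cons_conv)
  then show "p = 0" by (simp add: poly_eqI)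
qed (use line_scale_basis[of 0 a] in simp)

end

section \<open>The codes of polynomials\<close>

locale free_lie_three = free_lie_rep scale bracket basis rep
  for scale :: "'k::field \<Rightarrow> 'l::ab_group_add \<Rightarrow> 'l" and bracket :: "'l \<Rightarrow> 'l \<Rightarrow> 'l"
    and basis :: "'x \<Rightarrow> 'l" and rep :: "'l \<Rightarrow> ('x, 'k) free_assoc" +
  fixes a b c :: 'x
  assumes ab: "a \<noteq> b" and ac: "a \<noteq> c" and bc: "b \<noteq> c"
begin

abbreviation "A \<equiv> basis a"
abbreviation "B \<equiv> basis b"
abbreviation "C \<equiv> basis c"

lemma coef_transfer:
  assumes "bracket u C + bracket B v \<in> range (bracket A)"
  shows "coef (rep u) (replicate k a @ b # w) = - coef (rep v) (w @ c # replicate k a)"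
proof -
  obtain y where "bracket u C + bracket B v = bracket A y" using assms by auto
  then have "commutator (rep u) (letter c) + commutator (letter b) (rep v) = commutator (letter a) (rep y)"
    by (metis rep_add rep_bracket rep_basis)
  then show ?thesis using ab ac bc by (rule rotation_transfer)
qed

text \<open>A word of \<open>u\<close> with two letters \<open>b\<close> transfers to a word of
  \<open>v\<close> containing \<open>b\<close>, excluded by \<open>poly_hull_support\<close>. Words
  of \<open>v\<close> with a \<open>c\<close> transfer back to \<open>u\<close>, which
  vanishes.\<close>

lemma poly_pair_vanish:
  assumes pair: "poly_pair A B C u v"
    and lin: "\<And>w. set w \<subseteq> {a, b} \<Longrightarrow> count_list w b \<le> 1 \<Longrightarrow> coef (rep u) w = 0"
  shows "rep u = 0" and "v \<in> line a"
proof -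
  have transfer: "coef (rep u) (replicate k a @ b # w) = - coef (rep v) (w @ c # replicate k a)" for k w
    using pair coef_transfer by (simp add: poly_pair_def)
  have v_supp: "coef (rep v) w = 0" if "\<not> set w \<subseteq> {a, c}" for w
    using pair poly_hull_support[OF _ ac that] by (simp add: poly_pair_def)
  show "rep u = 0"
  proof (rule poly_mapping_eqI)
    fix w
    consider "\<not> set w \<subseteq> {a, b}" | "set w \<subseteq> {a, b}" "count_list w b \<le> 1"
      | "set w \<subseteq> {a, b}" "count_list w b > 1" by linarith
    then show "coef (rep u) w = coef 0 w"
    proof cases
      case 1
      then show ?thesis
        using pair poly_hull_support[OF _ ab 1] by (simp add: poly_pair_def)
    next
      case 2
      then show ?thesis using lin by simp
    next
      case 3
      then have "b \<in> set w" using count_list_0_iff[of w b] by linarith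
      \<comment> \<open>Splitting at the first \<open>b\<close> leaves a prefix consisting of
        \<open>a\<close> only, the form required by \<open>transfer\<close>.\<close>
      then obtain w1 w2 where w: "w = w1 @ b # w2" "b \<notin> set w1"
        by (metis split_list_first)
      then have "w1 = replicate (length w1) a"
        using 3(1) by (auto intro!: replicate_eqI)
      moreover have "b \<in> set w2"
        using 3(2) w count_list_0_iff[of w1 b] count_list_0_iff[of w2 b] by auto
      ultimately show ?thesis
        using transfer[of "length w1" w2] v_supp[of "w2 @ c # w1"] ab bc w(1) by auto
    qed
  qed
  \<comment> \<open>This supplies the multiple \<open>k\<close> of \<open>letter a\<close>; on words
    without \<open>c\<close> the part \<open>act A p C\<close> vanishes.\<close>
  obtain k p where kp: "set w \<subseteq> {a, c} \<Longrightarrow> count_list w c \<le> 1 \<Longrightarrow>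
    coef (rep v) w = coef (rep (scale k A + act A p C)) w" for w
    using linear_part[OF ac, of v] by blast
  have "rep v = assoc_scale k (letter a)"
  proof (rule poly_mapping_eqI)
    fix w
    consider "\<not> set w \<subseteq> {a, c}" | "set w \<subseteq> {a, c}" "c \<notin> set w" | "set w \<subseteq> {a, c}" "c \<in> set w"
      by blast
    then show "coef (rep v) w = coef (assoc_scale k (letter a)) w"
    proof cases
      case 1
      then show ?thesis using v_supp by (auto simp: coef_letter)
    next
      case 2
      then show ?thesis
        using kp[of w] coef_act_no_letter[OF ac 2(2)]
        by (simp add: rep_add rep_scale rep_basis lookup_add)
    next
      case 3
      then obtain w1 w2 where w: "w = w1 @ c # w2" "c \<notin> set w2"
        by (metis split_list_last)
      then have "w2 = replicate (length w2) a"
        using 3(1) by (auto intro!: replicate_eqI)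
      then have "coef (rep v) w = 0"
        using transfer[of "length w2" w1] w(1) \<open>rep u = 0\<close> by simp
      then show ?thesis using 3(2) ac by (auto simp: coef_letter)
    qed
  qed
  then show "v \<in> line a" by (auto simp: line_def)
qed

text \<open>Subtract the standard pair whose polynomial is read off from the linear part of
  \<open>u\<close>; \<open>poly_pair_vanish\<close> puts the difference into the line.\<close>

theorem poly_pair_iff:
  "poly_pair A B C u v \<longleftrightarrow> (\<exists>p. u - act A p B \<in> line a \<and> v + act (- A) p C \<in> line a)"
proof
  assume pair: "poly_pair A B C u v"
  obtain k p where kp: "set w \<subseteq> {a, b} \<Longrightarrow> count_list w b \<le> 1 \<Longrightarrow>
    coef (rep u) w = coef (rep (scale k A + act A p B)) w" for w
    using linear_part[OF ab, of u] by blast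
  \<comment> \<open>The zero summand \<open>scale 0 A\<close> gives the second member the shape of a
    sum of a line pair and a standard pair.\<close>
  have "poly_pair A B C (scale k A + act A p B) (scale 0 A + - act (- A) p C)"
    by (intro poly_pair_add poly_pair_act line_poly_pair line_scale_basis)
  then have diff: "poly_pair A B C (u - (scale k A + act A p B)) (v - (scale 0 A + - act (- A) p C))"
    using pair poly_pair_diff by blast
  have van: "coef (rep (u - (scale k A + act A p B))) w = 0"
    if "set w \<subseteq> {a, b}" "count_list w b \<le> 1" for w
    using kp[OF that] by (simp add: rep_diff lookup_minus)
  have "u - (scale k A + act A p B) \<in> line a"
    using poly_pair_vanish(1)[OF diff van] by (rule line_kernel)
  from line_add[OF this line_scale_basis[of k]] poly_pair_vanish(2)[OF diff van]
  show "\<exists>p. u - act A p B \<in> line a \<and> v + act (- A) p C \<in> line a"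
    by (auto simp: algebra_simps)
next
  assume "\<exists>p. u - act A p B \<in> line a \<and> v + act (- A) p C \<in> line a"
  then obtain p where "u - act A p B \<in> line a" "v + act (- A) p C \<in> line a" by blast
  from poly_pair_add[OF line_poly_pair[OF this] poly_pair_act]
  show "poly_pair A B C u v" by (metis add_diff_cancel_right' diff_add_cancel diff_minus_eq_add add_uminus_conv_diff)
qed

end

section \<open>Closure properties of definable sets\<close>

primrec rename :: "(nat \<Rightarrow> nat) \<Rightarrow> 'l rterm \<Rightarrow> 'l rterm" where
  "rename f (Var i) = Var (f i)"
| "rename f (Const x) = Const x"
| "rename f (Plus s t) = Plus (rename f s) (rename f t)"
| "rename f (Neg s) = Neg (rename f s)"
| "rename f (Bracket s t) = Bracket (rename f s) (rename f t)"

lemma rvars_rename: "rvars (rename f t) = f ` rvars t"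
  by (induction t) auto

lemma reval_rename:
  "(\<And>i. i \<in> rvars t \<Longrightarrow> vs ! f i = vs' ! i) \<Longrightarrow> reval br vs (rename f t) = reval br vs' t"
  by (induction t) simp_all

lemma reval_cong:
  "(\<And>i. i \<in> rvars t \<Longrightarrow> vs ! i = vs' ! i) \<Longrightarrow> reval br vs t = reval br vs' t"
  by (induction t) simp_all

lemma reval_append:
  "rvars t \<subseteq> {..<length vs} \<Longrightarrow> reval br (vs @ ws) t = reval br vs t"
  by (rule reval_cong) (auto simp: nth_append)

lemma e_definable_eq:
  assumes "rvars s \<subseteq> {..<m}" "rvars t \<subseteq> {..<m}"
  shows "e_definable br m {cs. length cs = m \<and> reval br cs s = reval br cs t}"
  unfolding e_definable_def
  using assms by (intro conjI exI[of _ "0::nat"] exI[of _ "{(s, t)}"]) auto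

lemma ex_length_add_iff:
  "(\<exists>ys. length ys = k + l \<and> Q ys) \<longleftrightarrow> (\<exists>ys zs. length ys = k \<and> length zs = l \<and> Q (ys @ zs))"
proof
  assume "\<exists>ys. length ys = k + l \<and> Q ys"
  then obtain ys where "length ys = k + l" "Q ys" by blast
  then have "length (take k ys) = k" "length (drop k ys) = l" "Q (take k ys @ drop k ys)" by simp_all
  then show "\<exists>ys zs. length ys = k \<and> length zs = l \<and> Q (ys @ zs)" by blast
qed (metis length_append)

lemma ex_length_Suc_iff:
  "(\<exists>ys. length ys = Suc k \<and> Q ys) \<longleftrightarrow> (\<exists>y ys. length ys = k \<and> Q (y # ys))"
  by (auto simp: length_Suc_conv)

lemma e_definable_Int:
  assumes "e_definable br m X" "e_definable br m Y"
  shows "e_definable br m (X \<inter> Y)"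
proof -
  obtain k S where S: "X \<subseteq> {cs. length cs = m}" "finite S"
    "\<forall>(s, t) \<in> S. rvars s \<union> rvars t \<subseteq> {..<m + k}"
    "\<forall>cs. length cs = m \<longrightarrow> (cs \<in> X \<longleftrightarrow>
      (\<exists>ys. length ys = k \<and> (\<forall>(s, t) \<in> S. reval br (cs @ ys) s = reval br (cs @ ys) t)))"
    using assms(1) unfolding e_definable_def by blast
  obtain l T where T: "finite T"
    "\<forall>(s, t) \<in> T. rvars s \<union> rvars t \<subseteq> {..<m + l}"
    "\<forall>cs. length cs = m \<longrightarrow> (cs \<in> Y \<longleftrightarrow>
      (\<exists>ys. length ys = l \<and> (\<forall>(s, t) \<in> T. reval br (cs @ ys) s = reval br (cs @ ys) t)))"
    using assms(2) unfolding e_definable_def by blast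
  \<comment> \<open>The witnesses for \<open>Y\<close> are placed after the \<open>k\<close>
    witnesses for \<open>X\<close>; the first \<open>m\<close> variables are shared.\<close>
  define f where "f i = (if i < m then i else i + k)" for i
  define T' where "T' = map_prod (rename f) (rename f) ` T"
  have left: "reval br (cs @ ys @ zs) s = reval br (cs @ ys) s"
    if "length cs = m" "length ys = k" "rvars s \<subseteq> {..<m + k}" for cs ys zs s
    using reval_append[of s "cs @ ys" br zs] that by simp
  have right: "reval br (cs @ ys @ zs) (rename f s) = reval br (cs @ zs) s"
    if "length cs = m" "length ys = k" for cs ys zs s
    by (rule reval_rename) (use that in \<open>auto simp: f_def nth_append\<close>)
  show ?thesis
    unfolding e_definable_def
  proof (intro conjI exI[of _ "k + l"] exI[of _ "S \<union> T'"] allI impI)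
    show "X \<inter> Y \<subseteq> {cs. length cs = m}" using S(1) by blast
    show "finite (S \<union> T')" using S(2) T(1) by (simp add: T'_def)
    show "\<forall>(s, t)\<in>S \<union> T'. rvars s \<union> rvars t \<subseteq> {..<m + (k + l)}"
      using S(3) T(2) by (fastforce simp: T'_def rvars_rename f_def)
    fix cs :: "'a list" assume cs: "length cs = m"
    have "(\<exists>ys. length ys = k + l \<and>
        (\<forall>(s, t)\<in>S \<union> T'. reval br (cs @ ys) s = reval br (cs @ ys) t)) \<longleftrightarrow>
      (\<exists>ys zs. length ys = k \<and> length zs = l \<and>
        (\<forall>(s, t)\<in>S \<union> T'. reval br (cs @ ys @ zs) s = reval br (cs @ ys @ zs) t))"
      by (rule ex_length_add_iff)
    also have "\<dots> \<longleftrightarrow> (\<exists>ys zs. length ys = k \<and> length zs = l \<and>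
        (\<forall>(s, t)\<in>S. reval br (cs @ ys) s = reval br (cs @ ys) t) \<and>
        (\<forall>(s, t)\<in>T. reval br (cs @ zs) s = reval br (cs @ zs) t))"
    proof (intro ex_cong1 conj_cong refl)
      fix ys zs :: "'a list" assume len: "length ys = k" "length zs = l"
      have "(\<forall>(s, t)\<in>S. reval br (cs @ ys @ zs) s = reval br (cs @ ys @ zs) t) \<longleftrightarrow>
          (\<forall>(s, t)\<in>S. reval br (cs @ ys) s = reval br (cs @ ys) t)"
        using left[OF cs len(1)] S(3) by (intro ball_cong) auto
      moreover have "(\<forall>(s, t)\<in>T'. reval br (cs @ ys @ zs) s = reval br (cs @ ys @ zs) t) \<longleftrightarrow>
          (\<forall>(s, t)\<in>T. reval br (cs @ zs) s = reval br (cs @ zs) t)"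
        using right[OF cs len(1)] by (simp add: T'_def case_prod_unfold)
      ultimately show "(\<forall>(s, t)\<in>S \<union> T'. reval br (cs @ ys @ zs) s = reval br (cs @ ys @ zs) t) \<longleftrightarrow>
        (\<forall>(s, t)\<in>S. reval br (cs @ ys) s = reval br (cs @ ys) t) \<and>
        (\<forall>(s, t)\<in>T. reval br (cs @ zs) s = reval br (cs @ zs) t)"
        by (simp add: ball_Un)
    qed simp_all
    also have "\<dots> \<longleftrightarrow> cs \<in> X \<inter> Y"
      using S(4)[rule_format, OF cs] T(3)[rule_format, OF cs] by blast
    finally show "cs \<in> X \<inter> Y \<longleftrightarrow> (\<exists>ys. length ys = k + l \<and>
        (\<forall>(s, t)\<in>S \<union> T'. reval br (cs @ ys) s = reval br (cs @ ys) t))" ..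
  qed
qed

lemma e_definable_conj:
  assumes "e_definable br m {cs. length cs = m \<and> P cs}" "e_definable br m {cs. length cs = m \<and> Q cs}"
  shows "e_definable br m {cs. length cs = m \<and> P cs \<and> Q cs}"
proof -
  have "{cs. length cs = m \<and> P cs \<and> Q cs} =
      {cs. length cs = m \<and> P cs} \<inter> {cs. length cs = m \<and> Q cs}" by auto
  then show ?thesis using e_definable_Int[OF assms] by simp
qed

text \<open>The quantified entry sits at position \<open>m\<close>, so the same equations serve with
  one more auxiliary variable.\<close>

lemma e_definable_ex:
  assumes "e_definable br (Suc m) {cs. length cs = Suc m \<and> P cs}"
  shows "e_definable br m {cs. length cs = m \<and> (\<exists>y. P (cs @ [y]))}"
proof -
  obtain k S where S: "finite S" "\<forall>(s, t) \<in> S. rvars s \<union> rvars t \<subseteq> {..<Suc m + k}"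
    "\<And>cs. length cs = Suc m \<Longrightarrow> P cs \<longleftrightarrow>
      (\<exists>ys. length ys = k \<and> (\<forall>(s, t) \<in> S. reval br (cs @ ys) s = reval br (cs @ ys) t))"
    using assms unfolding e_definable_def by auto
  show ?thesis
    unfolding e_definable_def
  proof (intro conjI exI[of _ "Suc k"] exI[of _ S] allI impI)
    fix cs :: "'a list" assume cs: "length cs = m"
    have "(\<exists>y. P (cs @ [y])) \<longleftrightarrow> (\<exists>y ys. length ys = k \<and>
        (\<forall>(s, t) \<in> S. reval br (cs @ y # ys) s = reval br (cs @ y # ys) t))"
      using S(3)[of "cs @ [y]" for y] cs by simp
    also have "\<dots> \<longleftrightarrow> (\<exists>ys. length ys = Suc k \<and>
        (\<forall>(s, t) \<in> S. reval br (cs @ ys) s = reval br (cs @ ys) t))"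
      by (rule ex_length_Suc_iff[symmetric])
    finally show "cs \<in> {cs. length cs = m \<and> (\<exists>y. P (cs @ [y]))} \<longleftrightarrow>
        (\<exists>ys. length ys = Suc k \<and> (\<forall>(s, t) \<in> S. reval br (cs @ ys) s = reval br (cs @ ys) t))"
      using cs by simp
  qed (use S in auto)
qed

lemma e_definable_cong:
  assumes "e_definable br m {cs. length cs = m \<and> P cs}" "\<And>cs. length cs = m \<Longrightarrow> P cs \<longleftrightarrow> Q cs"
  shows "e_definable br m {cs. length cs = m \<and> Q cs}"
proof -
  have "{cs. length cs = m \<and> P cs} = {cs. length cs = m \<and> Q cs}" using assms(2) by auto
  then show ?thesis using assms(1) by simp
qed

lemma e_definable_range:
  assumes "rvars t \<subseteq> {..<m}"
  shows "e_definable br m {cs. length cs = m \<and> reval br cs t \<in> range (br z)}"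
  by (rule e_definable_cong[OF e_definable_ex[OF e_definable_eq[of t _ "Bracket (Const z) (Var m)"]]])
     (use assms in \<open>auto simp: reval_append nth_append\<close>)

section \<open>Equations for hulls and pairs\<close>

context lie_algebra
begin

lemma e_definable_poly_hull:
  assumes t: "rvars t \<subseteq> {..<m}"
  shows "e_definable bracket m {cs. length cs = m \<and> reval bracket cs t \<in> poly_hull z x}"
  \<comment> \<open>\<open>Var m\<close> and \<open>Var (Suc m)\<close> are the two elements in
    \<open>poly_hull_def\<close>; the range conditions place them in \<open>orth\<close>.\<close>
  by (rule e_definable_cong[OF e_definable_ex[OF e_definable_ex[OF e_definable_conj[OF
        e_definable_eq[of t _ "Plus (Var m) (Bracket (Const z) (Var (Suc m)))"] e_definable_conj[OF
        e_definable_range[of "Bracket (Var m) (Const x)" _ bracket z]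
        e_definable_range[of "Bracket (Var (Suc m)) (Const x)" _ bracket z]]]]]])
     (use t in \<open>auto simp: reval_append nth_append poly_hull_def orth_def\<close>)

lemma e_definable_poly_pair:
  assumes "rvars s \<subseteq> {..<m}" "rvars t \<subseteq> {..<m}"
  shows "e_definable bracket m
    {cs. length cs = m \<and> poly_pair z x y (reval bracket cs s) (reval bracket cs t)}"
  by (rule e_definable_cong[OF e_definable_conj[OF
        e_definable_poly_hull[of s _ z x] e_definable_conj[OF e_definable_poly_hull[of t _ z y]
        e_definable_range[of "Plus (Bracket s (Const y)) (Bracket (Const x) t)" _ bracket z]]]])
     (use assms in \<open>auto simp: poly_pair_def\<close>)

lemma e_definable_ex_poly_pair:
  assumes "i < m"
  shows "e_definable bracket m {cs. length cs = m \<and> (\<exists>v. poly_pair z x y (cs ! i) v)}"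
  by (rule e_definable_cong[OF e_definable_ex[OF e_definable_poly_pair[of "Var i" _ "Var m" z x y]]])
     (use assms in \<open>auto simp: nth_append\<close>)

end

section \<open>The interpretation\<close>

context free_lie_three
begin

text \<open>A relation, since the codes of one polynomial form a coset of
  \<open>line a\<close>.\<close>

definition codes :: "'l \<Rightarrow> 'k poly \<Rightarrow> bool" where
  "codes u p \<longleftrightarrow> u - act A p B \<in> line a"

lemma ex_poly_pair_iff: "(\<exists>v. poly_pair A B C u v) \<longleftrightarrow> (\<exists>p. codes u p)"
proof
  assume "\<exists>p. codes u p"
  then obtain p where "codes u p" by blast
  moreover have "- act (- A) p C + act (- A) p C \<in> line a"
    using line_scale_basis[of 0 a] by simp
  ultimately show "\<exists>v. poly_pair A B C u v"
    unfolding poly_pair_iff codes_def by blast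
qed (auto simp: poly_pair_iff codes_def)

lemma codes_act: "codes (act A p B) p"
  using line_scale_basis[of 0 a] by (simp add: codes_def)

lemma codes_add: "codes u p \<Longrightarrow> codes v q \<Longrightarrow> codes (u + v) (p + q)"
  unfolding codes_def using line_add[of "u - act A p B" a "v - act A q B"]
  by (simp add: act_add algebra_simps)

lemma codes_diff: "codes u p \<Longrightarrow> codes v q \<Longrightarrow> codes (u - v) (p - q)"
  unfolding codes_def using line_diff[of "u - act A p B" a "v - act A q B"]
  by (simp add: act_diff algebra_simps)

text \<open>The line part commutes with \<open>A\<close>, and [p(ad a) b, a] = - (t p)(ad a) b.
  Applied to differences of codes, this expresses equality and sums by an equation.\<close>

lemma codes_commute_iff:
  assumes "codes u p"
  shows "bracket u A = 0 \<longleftrightarrow> p = 0"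
proof -
  have "bracket u A = bracket (act A p B) A"
    using line_bracket_basis[of "u - act A p B" a] assms by (simp add: codes_def bracket_bilinear)
  also have "\<dots> = - act A (pCons 0 p) B"
    using bracket_swap[of "act A p B" A] by simp
  finally have "bracket u A = - act A (pCons 0 p) B" .
  moreover have "act A (pCons 0 p) B = 0 \<longleftrightarrow> p = 0"
    using act_in_line_iff[OF ab, of "pCons 0 p"] line_scale_basis[of 0 a] by auto
  ultimately show ?thesis by simp
qed

lemma codes_unique: "codes u p \<Longrightarrow> codes u q \<Longrightarrow> p = q"
  using codes_diff[of u p u q] codes_commute_iff[of 0 "p - q"] by simp

text \<open>\<open>coef_transfer\<close> with second member 0 makes the coefficients at all words
  a^n b vanish. This is the zero test used for products.\<close>

lemma codes_orth_iff:
  assumes "codes u p"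
  shows "bracket u C \<in> range (bracket A) \<longleftrightarrow> p = 0"
proof -
  have u: "bracket u C = bracket (u - act A p B) C + bracket (act A p B) C"
    by (simp add: bracket_bilinear)
  have l: "bracket (u - act A p B) C \<in> range (bracket A)"
    using assms by (simp add: codes_def line_bracket_in_range)
  show ?thesis
  proof
    assume "bracket u C \<in> range (bracket A)"
    then have "bracket (act A p B) C + bracket B 0 \<in> range (bracket A)"
      using range_ad_diff[OF _ l] u by fastforce
    from coef_transfer[OF this, of _ "[]"] have "coeff p n = 0" for n
      by (simp add: coef_act[OF ab])
    then show "p = 0" by (simp add: poly_eqI)
  next
    assume "p = 0"
    then show "bracket u C \<in> range (bracket A)" using u l by simp
  qed
qed

lemma codes_mult_iff:
  assumes u: "codes u p" and v: "poly_pair A B C u' v" "codes u' q" and w: "codes w r"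
  shows "bracket u v + bracket w C \<in> range (bracket A) \<longleftrightarrow> p * q = r"
proof -
  \<comment> \<open>The pair brings its own polynomial; as \<open>u'\<close> codes both, it equals
    \<open>q\<close>.\<close>
  obtain q' where "codes u' q'" "v + act (- A) q' C \<in> line a"
    using v(1) by (auto simp: poly_pair_iff codes_def)
  then have v': "v + act (- A) q C \<in> line a" using codes_unique[OF v(2)] by simp
  let ?P = "act A p B" and ?Q = "act (- A) q C"
  have "bracket u v + bracket ?P ?Q
      = bracket (u - ?P) v + bracket ?P (v + ?Q)"
    by (simp add: bracket_bilinear)
  also have "\<dots> \<in> range (bracket A)"
    using u v' by (auto simp: codes_def intro: range_ad_add line_bracket_in_range line_bracket_in_range')
  finally have 1: "bracket u v + bracket ?P ?Q \<in> range (bracket A)" .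
  \<comment> \<open>Adjointness moves \<open>q\<close> from \<open>C\<close> to the other argument,
    where it composes with \<open>p\<close>.\<close>
  have 2: "bracket (act A (q * p) B) C - bracket ?P ?Q \<in> range (bracket A)"
    using act_adjoint[of A q ?P C] by (simp add: act_mult)
  have "bracket u v + bracket w C = (bracket u v + bracket ?P ?Q)
      + (bracket (act A (q * p) B) C - bracket ?P ?Q) + bracket (w - act A (p * q) B) C"
    by (simp add: bracket_bilinear mult.commute)
  then have "bracket u v + bracket w C \<in> range (bracket A) \<longleftrightarrow>
      bracket (w - act A (p * q) B) C \<in> range (bracket A)"
    using range_ad_add[OF range_ad_add[OF 1 2]] range_ad_diff[OF _ range_ad_add[OF 1 2]]
    by (metis add_diff_cancel_left')
  also have "\<dots> \<longleftrightarrow> r - p * q = 0"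
    using codes_orth_iff codes_diff[OF w codes_act] by blast
  finally show ?thesis by auto
qed

definition decode :: "'l list \<Rightarrow> 'k poly" where
  "decode us = (THE p. codes (us ! 0) p)"

lemma decode_eq: "codes u p \<Longrightarrow> decode [u] = p"
  unfolding decode_def using codes_unique by auto

theorem e_interpretation_decode:
  "e_interpretation bracket 1 {us. length us = 1 \<and> (\<exists>v. poly_pair A B C (us ! 0) v)} decode"
  (is "e_interpretation bracket 1 ?X decode")
proof -
  have X: "us \<in> ?X \<longleftrightarrow> (\<exists>u p. us = [u] \<and> codes u p)" for us
    by (auto simp: ex_poly_pair_iff length_Suc_conv)
  \<comment> \<open>The preimage of \<open>R\<close> is the coding condition on each entry together
    with any \<open>T\<close> that expresses \<open>R\<close> on codes; \<open>three\<close> is the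
    ternary version.\<close>
  have two: "{us @ vs | us vs. us \<in> ?X \<and> vs \<in> ?X \<and> R (decode us) (decode vs)} =
      {ws. length ws = 2 \<and> (\<exists>v. poly_pair A B C (ws ! 0) v) \<and> (\<exists>v. poly_pair A B C (ws ! 1) v) \<and> T ws}"
    if "\<And>u v p q. codes u p \<Longrightarrow> codes v q \<Longrightarrow> R p q \<longleftrightarrow> T [u, v]" for R T
  proof (intro set_eqI iffI)
    fix ws assume "ws \<in> {us @ vs | us vs. us \<in> ?X \<and> vs \<in> ?X \<and> R (decode us) (decode vs)}"
    then obtain u v p q where "ws = [u, v]" "codes u p" "codes v q" "R p q"
      unfolding X using decode_eq by fastforce
    then show "ws \<in> {ws. length ws = 2 \<and> (\<exists>v. poly_pair A B C (ws ! 0) v) \<and>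
        (\<exists>v. poly_pair A B C (ws ! 1) v) \<and> T ws}"
      using that by (auto simp: ex_poly_pair_iff)
  next
    fix ws assume "ws \<in> {ws. length ws = 2 \<and> (\<exists>v. poly_pair A B C (ws ! 0) v) \<and>
        (\<exists>v. poly_pair A B C (ws ! 1) v) \<and> T ws}"
    then obtain u v p q where ws: "ws = [u, v]" "codes u p" "codes v q" "T [u, v]"
      by (auto simp: ex_poly_pair_iff length_Suc_conv numeral_2_eq_2)
    have "ws = [u] @ [v]" "[u] \<in> ?X" "[v] \<in> ?X" "R (decode [u]) (decode [v])"
      unfolding X using ws that decode_eq by auto
    then show "ws \<in> {us @ vs | us vs. us \<in> ?X \<and> vs \<in> ?X \<and> R (decode us) (decode vs)}"
      by blast
  qed
  have three: "{us @ vs @ ws | us vs ws. us \<in> ?X \<and> vs \<in> ?X \<and> ws \<in> ?X \<and> R (decode us) (decode vs) (decode ws)} =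
      {ws. length ws = 3 \<and> (\<exists>v. poly_pair A B C (ws ! 0) v) \<and> (\<exists>v. poly_pair A B C (ws ! 1) v) \<and>
        (\<exists>v. poly_pair A B C (ws ! 2) v) \<and> T ws}"
    if "\<And>u v w p q r. codes u p \<Longrightarrow> codes v q \<Longrightarrow> codes w r \<Longrightarrow> R p q r \<longleftrightarrow> T [u, v, w]" for R T
  proof (intro set_eqI iffI)
    fix xs assume "xs \<in> {us @ vs @ ws | us vs ws. us \<in> ?X \<and> vs \<in> ?X \<and> ws \<in> ?X \<and>
        R (decode us) (decode vs) (decode ws)}"
    then obtain u v w p q r where "xs = [u, v, w]" "codes u p" "codes v q" "codes w r" "R p q r"
      unfolding X using decode_eq by fastforce
    then show "xs \<in> {ws. length ws = 3 \<and> (\<exists>v. poly_pair A B C (ws ! 0) v) \<and>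
        (\<exists>v. poly_pair A B C (ws ! 1) v) \<and> (\<exists>v. poly_pair A B C (ws ! 2) v) \<and> T ws}"
      using that by (auto simp: ex_poly_pair_iff)
  next
    fix xs assume "xs \<in> {ws. length ws = 3 \<and> (\<exists>v. poly_pair A B C (ws ! 0) v) \<and>
        (\<exists>v. poly_pair A B C (ws ! 1) v) \<and> (\<exists>v. poly_pair A B C (ws ! 2) v) \<and> T ws}"
    then obtain u v w p q r where xs: "xs = [u, v, w]" "codes u p" "codes v q" "codes w r" "T [u, v, w]"
      by (auto simp: ex_poly_pair_iff length_Suc_conv numeral_3_eq_3 numeral_2_eq_2)
    have "xs = [u] @ [v] @ [w]" "[u] \<in> ?X" "[v] \<in> ?X" "[w] \<in> ?X"
      "R (decode [u]) (decode [v]) (decode [w])"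
      unfolding X using xs that decode_eq by auto
    then show "xs \<in> {us @ vs @ ws | us vs ws. us \<in> ?X \<and> vs \<in> ?X \<and> ws \<in> ?X \<and>
        R (decode us) (decode vs) (decode ws)}"
      by blast
  qed
  show ?thesis
    unfolding e_interpretation_def
  proof (intro conjI)
    show "e_definable bracket 1 ?X"
      by (rule e_definable_ex_poly_pair) simp
    show "decode ` ?X = UNIV"
    proof -
      have "p = decode [act A p B]" "[act A p B] \<in> ?X" for p
        unfolding X using decode_eq[OF codes_act] codes_act by auto
      then show ?thesis by blast
    qed
    show "e_definable bracket (2 * 1) {us @ vs | us vs. us \<in> ?X \<and> vs \<in> ?X \<and> decode us = decode vs}"
    proof (subst two[where T = "\<lambda>ws. bracket (ws ! 0 - ws ! 1) A = 0"])
      show "p = q \<longleftrightarrow> bracket ([u, v] ! 0 - [u, v] ! 1) A = 0" if "codes u p" "codes v q" for u v p q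
        using codes_commute_iff[OF codes_diff[OF that]] by simp
      have "e_definable bracket 2 {ws. length ws = 2 \<and> bracket (ws ! 0 - ws ! 1) A = 0}"
        by (rule e_definable_cong[OF e_definable_eq[of "Bracket (Plus (Var 0) (Neg (Var 1))) (Const A)" _ "Const 0"]])
          auto
      then show "e_definable bracket (2 * 1) {ws. length ws = 2 \<and> (\<exists>v. poly_pair A B C (ws ! 0) v) \<and>
          (\<exists>v. poly_pair A B C (ws ! 1) v) \<and> bracket (ws ! 0 - ws ! 1) A = 0}"
        by (simp add: e_definable_conj e_definable_ex_poly_pair)
    qed
    show "e_definable bracket (3 * 1) {us @ vs @ ws | us vs ws.
        us \<in> ?X \<and> vs \<in> ?X \<and> ws \<in> ?X \<and> decode us + decode vs = decode ws}"
    proof (subst three[where T = "\<lambda>ws. bracket (ws ! 0 + ws ! 1 - ws ! 2) A = 0"])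
      show "p + q = r \<longleftrightarrow> bracket ([u, v, w] ! 0 + [u, v, w] ! 1 - [u, v, w] ! 2) A = 0"
        if "codes u p" "codes v q" "codes w r" for u v w p q r
        using codes_commute_iff[OF codes_diff[OF codes_add[OF that(1,2)] that(3)]] by simp
      have "e_definable bracket 3 {ws. length ws = 3 \<and> bracket (ws ! 0 + ws ! 1 - ws ! 2) A = 0}"
        by (rule e_definable_cong[OF e_definable_eq[of
              "Bracket (Plus (Plus (Var 0) (Var 1)) (Neg (Var 2))) (Const A)" _ "Const 0"]]) auto
      then show "e_definable bracket (3 * 1) {ws. length ws = 3 \<and> (\<exists>v. poly_pair A B C (ws ! 0) v) \<and>
          (\<exists>v. poly_pair A B C (ws ! 1) v) \<and> (\<exists>v. poly_pair A B C (ws ! 2) v) \<and>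
          bracket (ws ! 0 + ws ! 1 - ws ! 2) A = 0}"
        by (simp add: e_definable_conj e_definable_ex_poly_pair)
    qed
    show "e_definable bracket (3 * 1) {us @ vs @ ws | us vs ws.
        us \<in> ?X \<and> vs \<in> ?X \<and> ws \<in> ?X \<and> decode us * decode vs = decode ws}"
    \<comment> \<open>By \<open>codes_mult_iff\<close> any partner \<open>v\<close> of the second
      factor gives the same answer, so an existential quantifier suffices.\<close>
    proof (subst three[where T = "\<lambda>ws. \<exists>v. poly_pair A B C (ws ! 1) v \<and>
          bracket (ws ! 0) v + bracket (ws ! 2) C \<in> range (bracket A)"])
      show "p * q = r \<longleftrightarrow> (\<exists>y. poly_pair A B C ([u, v, w] ! 1) y \<and>
          bracket ([u, v, w] ! 0) y + bracket ([u, v, w] ! 2) C \<in> range (bracket A))"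
        if "codes u p" "codes v q" "codes w r" for u v w p q r
      proof -
        have "\<exists>y. poly_pair A B C v y" using ex_poly_pair_iff that(2) by blast
        then show ?thesis using codes_mult_iff[OF that(1) _ that(2,3)] by auto
      qed
      have "e_definable bracket 3 {ws. length ws = 3 \<and> (\<exists>v. poly_pair A B C (ws ! 1) v \<and>
          bracket (ws ! 0) v + bracket (ws ! 2) C \<in> range (bracket A))}"
        by (rule e_definable_cong[OF e_definable_ex[OF e_definable_conj[OF
              e_definable_poly_pair[of "Var 1" _ "Var 3" A B C]
              e_definable_range[of "Plus (Bracket (Var 0) (Var 3)) (Bracket (Var 2) (Const C))" _ bracket A]]]])
          (auto simp: nth_append)
      then show "e_definable bracket (3 * 1) {ws. length ws = 3 \<and> (\<exists>v. poly_pair A B C (ws ! 0) v) \<and>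
          (\<exists>v. poly_pair A B C (ws ! 1) v) \<and> (\<exists>v. poly_pair A B C (ws ! 2) v) \<and>
          (\<exists>v. poly_pair A B C (ws ! 1) v \<and>
            bracket (ws ! 0) v + bracket (ws ! 2) C \<in> range (bracket A))}"
        by (simp add: e_definable_conj e_definable_ex_poly_pair)
    qed
  qed
qed

end

text \<open>The universal property gives a map \<open>g\<close> from the constructed free Lie
  algebra to words, which is carried over along the isomorphism \<open>h\<close>.\<close>

lemma free_lie_algebra_rep:
  fixes scale :: "'k::field \<Rightarrow> 'l::ab_group_add \<Rightarrow> 'l" and basis :: "'x \<Rightarrow> 'l"
  assumes "free_lie_algebra scale bracket basis"
  obtains rep where "free_lie_rep scale bracket basis rep"
proof -
  interpret L: lie_algebra scale bracket
    using assms by (simp add: free_lie_algebra_def)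
  obtain h where h: "bij h" "lie_hom free_scale free_bracket scale bracket h" "\<And>x. h (free_gen x) = basis x"
    using assms by (auto simp: free_lie_algebra_def)
  obtain g :: "('x, 'k) free_lie \<Rightarrow> ('x, 'k) free_assoc"
    where g: "lie_hom free_scale free_bracket assoc_scale commutator g" "\<And>x. g (free_gen x) = letter x"
    using free_lie_universal[OF lie_algebra_commutator, of letter] by blast
  have h_hom: "h (u + v) = h u + h v" "h (free_scale k u) = scale k (h u)"
    "h (free_bracket u v) = bracket (h u) (h v)" for u v k
    using h(2) by (auto simp: lie_hom_def Vector_Spaces.linear_iff)
  have g_hom: "g (u + v) = g u + g v" "g (free_scale k u) = assoc_scale k (g u)"
    "g (free_bracket u v) = commutator (g u) (g v)" for u v k
    using g(1) by (auto simp: lie_hom_def Vector_Spaces.linear_iff)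
  have h_0: "h 0 = 0" using h_hom(1)[of 0 0] by simp
  have inv: "h (inv h u) = u" "inv h (h v) = v" for u v
    using h(1) by (simp_all add: bij_is_surj surj_f_inv_f bij_is_inj)
  have "free_lie_rep scale bracket basis (g \<circ> inv h)"
  proof
    fix u v :: 'l and k :: 'k and x :: 'x
    show "(g \<circ> inv h) (u + v) = (g \<circ> inv h) u + (g \<circ> inv h) v"
      by (metis comp_apply g_hom(1) h_hom(1) inv)
    show "(g \<circ> inv h) (scale k u) = assoc_scale k ((g \<circ> inv h) u)"
      by (metis comp_apply g_hom(2) h_hom(2) inv)
    show "(g \<circ> inv h) (bracket u v) = commutator ((g \<circ> inv h) u) ((g \<circ> inv h) v)"
      by (metis comp_apply g_hom(3) h_hom(3) inv)
    show "(g \<circ> inv h) (basis x) = letter x"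
      by (metis comp_apply g(2) h(3) inv(2))
  next
    fix P :: "'l \<Rightarrow> bool" and u
    assume P: "\<And>x. P (basis x)" "P 0" "\<And>u v. P u \<Longrightarrow> P v \<Longrightarrow> P (u + v)"
      "\<And>k u. P u \<Longrightarrow> P (scale k u)" "\<And>u v. P u \<Longrightarrow> P v \<Longrightarrow> P (bracket u v)"
    \<comment> \<open>Every element is the value of a formal expression, so \<open>generated\<close>
      follows by induction on expressions.\<close>
    have "P (h (abs_free_lie s))" for s
      by (induction s)
        (use P in \<open>simp_all add: h h_hom h_0 flip: free_gen.abs_eq plus_free_lie.abs_eq
          free_scale.abs_eq free_bracket.abs_eq zero_free_lie_def\<close>)
    moreover obtain s where "inv h u = abs_free_lie s"
      by (metis Quotient_abs_rep[OF Quotient_free_lie])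
    ultimately show "P u" using inv(1) by metis
  qed
  then show thesis by (rule that)
qed

theorem theorem3:
  fixes scale :: "'k::field \<Rightarrow> 'l::ab_group_add \<Rightarrow> 'l"
    and bracket :: "'l \<Rightarrow> 'l \<Rightarrow> 'l"
    and basis :: "'x \<Rightarrow> 'l"
  assumes "free_lie_algebra scale bracket basis"
    and "infinite (UNIV :: 'x set) \<or> card (UNIV :: 'x set) > 2"
  shows "e_interpretable TYPE('k poly) bracket"
proof -
  obtain rep where rep: "free_lie_rep scale bracket basis rep"
    using free_lie_algebra_rep[OF assms(1)] .
  \<comment> \<open>\<open>card\<close> is 0 on an infinite type, so infinite rank is a separate
    case; both cases yield three letters.\<close>
  obtain T :: "'x set" where "finite T" "card T = 3"
    using assms(2) infinite_arbitrarily_large[of "UNIV :: 'x set" 3]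
      obtain_subset_with_card_n[of 3 "UNIV :: 'x set"]
    by (metis Suc_leI eval_nat_numeral(3) finite_subset subset_UNIV)
  then obtain a b c :: 'x where "a \<noteq> b" "a \<noteq> c" "b \<noteq> c"
    by (auto simp: card_3_iff)
  then interpret free_lie_three scale bracket basis rep a b c
    using rep by (simp add: free_lie_three_def free_lie_three_axioms_def)
  show ?thesis
    unfolding e_interpretable_def using e_interpretation_decode by blast
qed

end
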